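(* Let $\sigma\in\mathbb R\setminus\{0\}$, $\lambda>0$, $M\in\mathbb N$, $\vec k=(k_1,\dots,k_M)$ with all $k_j>0$. Let $f\in C^3(X_c)$ and suppose there exists $\varepsilon'>0$ such that for each $0<\varepsilon<\varepsilon'$ we have a function $f_\varepsilon\in C^3(X_c)$, where, for each $\vec x\in X_c$, each partial derivative of order $3$ of the function $f_\varepsilon(\cdot/\varepsilon)$ is bounded in an $\varepsilon'$-neighbourhood of $\vec x$, uniformly in $\varepsilon$. If for each $\vec x\in X_c$ $$\lim_{\varepsilon\to0}f_\varepsilon(\vec x/\varepsilon)=f(\vec x)$$ and, for each $j=1,\dots,M-1$, $$\lim_{\varepsilon\to0}\Big[\big(\tfrac{\partial}{\partial x_j}-\tfrac{\partial}{\partial x_{j+1}}\big)f_\varepsilon(\cdot/\varepsilon)\Big](\vec x)=\Big[\big(\tfrac{\partial}{\partial x_j}-\tfrac{\partial}{\partial x_{j+1}}\big)f\Big](\vec x),$$ $$\lim_{\varepsilon\to0}\Big[\big(\tfrac{\partial}{\partial x_j}-\tfrac{\partial}{\partial x_{j+1}}\big)^2f_\varepsilon(\cdot/\varepsilon)\Big](\vec x)=\Big[\big(\tfrac{\partial}{\partial x_j}-\tfrac{\partial}{\partial x_{j+1}}\big)^2f\Big](\vec x),$$ then for each $\vec x\in X_c$ $$\lim_{\varepsilon\to0}\big[L^{\mathrm{ASIP}_{\mathsf L}}_{1-\varepsilon\sigma,\vec k,\lambda/\varepsilon}f_\varepsilon\big](\lfloor\vec x/\varepsilon\rfloor)=\big[L^{\mathrm{ABEP}_{\mathsf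 L}}_{\sigma,\vec k,\lambda}f\big](\vec x).$$
   Context: $X_c=\mathbb R_{\ge0}^M$, $X_d=\mathbb Z_{\ge0}^M\subset X_c$; $\lfloor\vec y\rfloor$ is componentwise rounding down; neighbourhoods are taken in $X_c$, and $\varepsilon$ is small enough that $\varepsilon|\sigma|<1$. "Bounded uniformly in $\varepsilon$" means bounded by a constant independent of $\varepsilon$. $\sinh_\sigma(x)=\sinh(\sigma x)$, $\cosh_\sigma(x)=\cosh(\sigma x)$, $E_j^-=E_j^-(\vec x)=\sum_{i=1}^jx_i$. Dynamic ABEP (left version), for $\sigma\ne0$, $\lambda>0$, has generator $$[L^{\mathrm{ABEP}_{\mathsf L}}_{\sigma,\vec k,\lambda}f](\vec x)=\sum_{j=1}^{M-1}A_j\Big(\frac{\partial}{\partial x_j}-\frac{\partial}{\partial x_{j+1}}\Big)^2f(\vec x)+B_j\Big(\frac{\partial}{\partial x_j}-\frac{\partial}{\partial x_{j+1}}\Big)f(\vec x),$$ $$A_j=\frac1{\sigma^2}\sinh_\sigma(x_j)\sinh_\sigma(x_{j+1})\frac{\sinh_\sigma(\lambda+2E_j^--x_j)\sinh_\sigma(\lambda+2E_j^-+x_{j+1})}{\sinh_\sigma(\lambda+2E_j^-)^2},$$ $$B_j=\frac1\sigma\Big[k_j\sinh_\sigma(x_{j+1})\frac{\sinh_\sigma(\lambda+2E_j^-+x_{j+1})}{\sinh_\sigma(\lambda+2E_j^-)}-k_{j+1}\sinh_\sigma(x_j)\frac{\sinh_\sigma(\lambda+2E_j^--x_j)}{\sinh_\sigma(\lambda+2E_j^-)}$$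 $$-2\sinh_\sigma(x_j)\sinh_\sigma(x_{j+1})\frac{\cosh_\sigma(\lambda+2E_j^-)\sinh_\sigma(\lambda+2E_j^--x_j)\sinh_\sigma(\lambda+2E_j^-+x_{j+1})}{\sinh_\sigma(\lambda+2E_j^-)^3}\Big].$$ Left dynamic ASIP: for $q>0$, $q\neq1$ and $\lambda>0$, with $[a]_q=\frac{q^a-q^{-a}}{q-q^{-1}}$, $h^-_0=\lambda$, $h^-_j(\zeta)=\lambda+\sum_{i\le j}(2\zeta_i+k_i)$, and $\zeta^{j,m}$ the state $\zeta$ with one particle moved from $j$ to $m$ if $\zeta_j\ge1$ (else $\zeta$), $$[L^{\mathrm{ASIP}_{\mathsf L}}_{q,\vec k,\lambda}f](\zeta)=\sum_{j=1}^{M-1}C_j^{\mathsf L,+}[f(\zeta^{j,j+1})-f(\zeta)]+C_{j+1}^{\mathsf L,-}[f(\zeta^{j+1,j})-f(\zeta)],\quad\zeta\in X_d,$$ $$C_j^{\mathsf L,+}=[\zeta_j]_q[\zeta_{j+1}+k_{j+1}]_q\frac{[h^-_{j-1}+\zeta_j]_q[h^-_j+\zeta_{j+1}]_q}{[h^-_j]_q[h^-_j-1]_q},\quad C_j^{\mathsf L,-}=[\zeta_j]_q[\zeta_{j-1}+k_{j-1}]_q\frac{[h^-_{j-1}-\zeta_{j-1}]_q[h^-_j-\zeta_j]_q}{[h^-_{j-1}]_q[h^-_{j-1}+1]_q},$$ where a rate is $0$ if the departing site $j$ is empty. $L^{\mathrm{ASIP}_{\mathsf L}}_{1-\varepsilon\sigma,\vec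 k,\lambda/\varepsilon}$ is this operator with $q=1-\varepsilon\sigma$ and boundary value $\lambda/\varepsilon$ in place of $\lambda$, applied to $f_\varepsilon|_{X_d}$. *)

theory Defs
  imports "HOL-Analysis.Analysis"
begin

text \<open>
  Vectors in \<open>\<real>\<^sup>M\<close> are functions \<^typ>\<open>nat \<Rightarrow> real\<close> with coordinates indexed by \<open>1, \<dots>, M\<close>
  and value \<open>0\<close> at every other index. On such functions the product topology
  of \<^typ>\<open>nat \<Rightarrow> real\<close>, which \<^const>\<open>continuous_on\<close> refers to, is the Euclidean topology.
\<close>

definition Xc :: "nat \<Rightarrow> (nat \<Rightarrow> real) set" where
  "Xc M = {x. (\<forall>i\<in>{1..M}. 0 \<le> x i) \<and> (\<forall>i. i \<notin> {1..M} \<longrightarrow> x i = 0)}"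

definition nbhd :: "nat \<Rightarrow> real \<Rightarrow> (nat \<Rightarrow> real) \<Rightarrow> (nat \<Rightarrow> real) set" where
  "nbhd M r x = {y \<in> Xc M. L2_set (\<lambda>i. y i - x i) {1..M} < r}"

text \<open>
  Partial derivatives are taken within \<open>Xc M\<close>, so they are one-sided at points with \<open>x i = 0\<close>;
  at points of \<open>Xc M\<close> they depend only on the values of \<open>f\<close> on \<open>Xc M\<close>.
\<close>

definition partially_differentiable :: "nat \<Rightarrow> ((nat \<Rightarrow> real) \<Rightarrow> real) \<Rightarrow> (nat \<Rightarrow> real) \<Rightarrow> bool" where
  "partially_differentiable i f x \<longleftrightarrow> (\<lambda>t. f (x(i := t))) differentiable (at (x i) within {0..})"

definition partial :: "nat \<Rightarrow> ((nat \<Rightarrow> real) \<Rightarrow> real) \<Rightarrow> (nat \<Rightarrow> real) \<Rightarrow> real" where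
  "partial i f x = vector_derivative (\<lambda>t. f (x(i := t))) (at (x i) within {0..})"

fun Ck :: "nat \<Rightarrow> nat \<Rightarrow> ((nat \<Rightarrow> real) \<Rightarrow> real) \<Rightarrow> bool" where
  "Ck M 0 f \<longleftrightarrow> continuous_on (Xc M) f"
| "Ck M (Suc n) f \<longleftrightarrow> continuous_on (Xc M) f \<and>
     (\<forall>i\<in>{1..M}. (\<forall>x\<in>Xc M. partially_differentiable i f x) \<and> Ck M n (partial i f))"

definition pdiff :: "nat \<Rightarrow> ((nat \<Rightarrow> real) \<Rightarrow> real) \<Rightarrow> (nat \<Rightarrow> real) \<Rightarrow> real" where
  "pdiff j f x = partial j f x - partial (j + 1) f x"

definition Eminus :: "nat \<Rightarrow> (nat \<Rightarrow> real) \<Rightarrow> real" where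
  "Eminus j x = (\<Sum>i=1..j. x i)"

definition sinhs :: "real \<Rightarrow> real \<Rightarrow> real" where
  "sinhs \<sigma> x = sinh (\<sigma> * x)"

definition coshs :: "real \<Rightarrow> real \<Rightarrow> real" where
  "coshs \<sigma> x = cosh (\<sigma> * x)"

definition abep_A :: "real \<Rightarrow> real \<Rightarrow> (nat \<Rightarrow> real) \<Rightarrow> nat \<Rightarrow> real" where
  "abep_A \<sigma> lam x j =
     1 / \<sigma>^2 * sinhs \<sigma> (x j) * sinhs \<sigma> (x (j+1)) *
     ((sinhs \<sigma> (lam + 2 * Eminus j x - x j) * sinhs \<sigma> (lam + 2 * Eminus j x + x (j+1))) /
      (sinhs \<sigma> (lam + 2 * Eminus j x))^2)"

definition abep_B :: "real \<Rightarrow> (nat \<Rightarrow> real) \<Rightarrow> real \<Rightarrow> (nat \<Rightarrow> real) \<Rightarrow> nat \<Rightarrow> real" where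
  "abep_B \<sigma> k lam x j =
     1 / \<sigma> *
     (k j * sinhs \<sigma> (x (j+1)) *
        (sinhs \<sigma> (lam + 2 * Eminus j x + x (j+1)) / sinhs \<sigma> (lam + 2 * Eminus j x))
    - k (j+1) * sinhs \<sigma> (x j) *
        (sinhs \<sigma> (lam + 2 * Eminus j x - x j) / sinhs \<sigma> (lam + 2 * Eminus j x))
    - 2 * sinhs \<sigma> (x j) * sinhs \<sigma> (x (j+1)) *
        ((coshs \<sigma> (lam + 2 * Eminus j x) * sinhs \<sigma> (lam + 2 * Eminus j x - x j)
            * sinhs \<sigma> (lam + 2 * Eminus j x + x (j+1))) /
         (sinhs \<sigma> (lam + 2 * Eminus j x))^3))"

definition abep_gen ::
  "nat \<Rightarrow> real \<Rightarrow> (nat \<Rightarrow> real) \<Rightarrow> real \<Rightarrow> ((nat \<Rightarrow> real) \<Rightarrow> real) \<Rightarrow> (nat \<Rightarrow> real) \<Rightarrow> real" where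
  "abep_gen M \<sigma> k lam f x =
     (\<Sum>j\<in>{1..<M}. abep_A \<sigma> lam x j * pdiff j (pdiff j f) x + abep_B \<sigma> k lam x j * pdiff j f x)"

text \<open>
  Particle configurations are functions \<^typ>\<open>nat \<Rightarrow> nat\<close>, again indexed by the sites \<open>1, \<dots>, M\<close>
  and \<open>0\<close> elsewhere. The map \<open>incl\<close> is the inclusion of the discrete state space into \<open>Xc M\<close>,
  so \<open>f \<circ> incl\<close> is the restriction of \<open>f\<close> to the discrete state space.
\<close>

definition incl :: "(nat \<Rightarrow> nat) \<Rightarrow> nat \<Rightarrow> real" where
  "incl \<zeta> = (\<lambda>i. real (\<zeta> i))"

definition floor_vec :: "(nat \<Rightarrow> real) \<Rightarrow> nat \<Rightarrow> nat" where
  "floor_vec y = (\<lambda>i. nat \<lfloor>y i\<rfloor>)"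

definition qnum :: "real \<Rightarrow> real \<Rightarrow> real" where
  "qnum q a = (q powr a - q powr (- a)) / (q - q powr (- 1))"

definition hminus :: "(nat \<Rightarrow> real) \<Rightarrow> real \<Rightarrow> (nat \<Rightarrow> nat) \<Rightarrow> nat \<Rightarrow> real" where
  "hminus k lam \<zeta> j = lam + (\<Sum>i=1..j. 2 * real (\<zeta> i) + k i)"

definition move :: "(nat \<Rightarrow> nat) \<Rightarrow> nat \<Rightarrow> nat \<Rightarrow> nat \<Rightarrow> nat" where
  "move \<zeta> j m = (if \<zeta> j \<ge> 1 then \<zeta>(j := \<zeta> j - 1, m := \<zeta> m + 1) else \<zeta>)"

definition rate_plus :: "real \<Rightarrow> (nat \<Rightarrow> real) \<Rightarrow> real \<Rightarrow> (nat \<Rightarrow> nat) \<Rightarrow> nat \<Rightarrow> real" where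
  "rate_plus q k lam \<zeta> j =
     (if \<zeta> j = 0 then 0
      else qnum q (real (\<zeta> j)) * qnum q (real (\<zeta> (j+1)) + k (j+1)) *
           ((qnum q (hminus k lam \<zeta> (j-1) + real (\<zeta> j)) * qnum q (hminus k lam \<zeta> j + real (\<zeta> (j+1)))) /
            (qnum q (hminus k lam \<zeta> j) * qnum q (hminus k lam \<zeta> j - 1))))"

definition rate_minus :: "real \<Rightarrow> (nat \<Rightarrow> real) \<Rightarrow> real \<Rightarrow> (nat \<Rightarrow> nat) \<Rightarrow> nat \<Rightarrow> real" where
  "rate_minus q k lam \<zeta> j =
     (if \<zeta> j = 0 then 0
      else qnum q (real (\<zeta> j)) * qnum q (real (\<zeta> (j-1)) + k (j-1)) *
           ((qnum q (hminus k lam \<zeta> (j-1) - real (\<zeta> (j-1))) * qnum q (hminus k lam \<zeta> j - real (\<zeta> j))) /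
            (qnum q (hminus k lam \<zeta> (j-1)) * qnum q (hminus k lam \<zeta> (j-1) + 1))))"

definition asip_gen ::
  "nat \<Rightarrow> real \<Rightarrow> (nat \<Rightarrow> real) \<Rightarrow> real \<Rightarrow> ((nat \<Rightarrow> nat) \<Rightarrow> real) \<Rightarrow> (nat \<Rightarrow> nat) \<Rightarrow> real" where
  "asip_gen M q k lam f \<zeta> =
     (\<Sum>j\<in>{1..<M}. rate_plus q k lam \<zeta> j * (f (move \<zeta> j (j+1)) - f \<zeta>)
                  + rate_minus q k lam \<zeta> (j+1) * (f (move \<zeta> (j+1) j) - f \<zeta>))"

definition rescale :: "real \<Rightarrow> ((nat \<Rightarrow> real) \<Rightarrow> real) \<Rightarrow> (nat \<Rightarrow> real) \<Rightarrow> real" where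
  "rescale \<epsilon> g = (\<lambda>y. g (\<lambda>i. y i / \<epsilon>))"

end

theory Submission
  imports Defs
begin

text \<open>
  Put \<open>g = f\<^sub>\<epsilon>(\<cdot>/\<epsilon>)\<close>, \<open>y = \<epsilon>\<lfloor>x/\<epsilon>\<rfloor>\<close> and \<open>D = \<partial>\<^sub>j - \<partial>\<^sub>j\<^sub>+\<^sub>1\<close>. A jump across the bond \<open>(j, j+1)\<close> changes
  \<open>g(y)\<close> by \<open>\<plusminus>\<epsilon> D g(y) + \<epsilon>\<^sup>2/2 D\<^sup>2 g(y) + O(\<epsilon>\<^sup>3)\<close>, so its contribution to the generator is
  \<open>\<epsilon> (C\<^sup>- - C\<^sup>+) D g(y) + \<epsilon>\<^sup>2 (C\<^sup>+ + C\<^sup>-)/2 D\<^sup>2 g(y) + O(\<epsilon>)\<close>.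
  The second-order term moves from \<open>y\<close> to \<open>x\<close> by the bounds on third derivatives. For the
  first-order term one needs \<open>\<partial>\<^sub>i D g\<close> to be bounded near \<open>x\<close>, which is not assumed: it follows from the
  convergence of \<open>D g\<close> at the two points \<open>x\<close> and \<open>x + r e\<^sub>i\<close> together with the bound on \<open>\<partial>\<^sub>i\<^sup>2 D g\<close>.
  With \<open>\<theta> = - ln (1 - \<epsilon>\<sigma>)\<close> one has \<open>[a]\<^sub>q = sinh (\<theta>a) / sinh \<theta>\<close>, and the rates \<open>C\<^sup>\<plusminus>\<close> are
  perturbations of order \<open>\<theta>\<close> of one common leading term. Hence \<open>C\<^sup>- - C\<^sup>+\<close> is one order smaller than
  \<open>C\<^sup>\<plusminus>\<close>, and the addition theorems for \<open>sinh\<close> reduce its limit to \<open>B\<^sub>j\<close>.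
\<close>

section \<open>Differential calculus on the orthant\<close>

lemma Xc_upd: "x \<in> Xc M \<Longrightarrow> i \<in> {1..M} \<Longrightarrow> t \<ge> 0 \<Longrightarrow> x(i := t) \<in> Xc M"
  by (auto simp: Xc_def)

lemma Xc_nonneg: "x \<in> Xc M \<Longrightarrow> 0 \<le> x i"
  by (cases "i \<in> {1..M}") (auto simp: Xc_def)

text \<open>Nontriviality makes derivatives within \<open>{0..}\<close> unique, so that
  \<open>partial\<close>, which is defined by choice, equals any derivative one can exhibit.\<close>

lemma at_within_nonneg_nontrivial: "(a::real) \<ge> 0 \<Longrightarrow> at a within {0..} \<noteq> bot"
proof -
  assume "a \<ge> 0"
  then have "at_right a \<le> at a within {0..}"
    by (intro at_le) auto
  then show ?thesis
    using trivial_limit_at_right_real[of a] by (metis bot.extremum_uniqueI)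
qed

lemma partial_eqI:
  assumes "((\<lambda>t. f (x(i := t))) has_real_derivative D) (at (x i) within {0..})" "x i \<ge> 0"
  shows "partial i f x = D"
  unfolding partial_def
  by (rule vector_derivative_within[OF at_within_nonneg_nontrivial])
    (use assms in \<open>auto simp: has_real_derivative_iff_has_vector_derivative\<close>)

lemma partial_at:
  assumes "partially_differentiable i f x"
  shows "((\<lambda>t. f (x(i := t))) has_real_derivative partial i f x) (at (x i) within {0..})"
  using assms unfolding partially_differentiable_def partial_def
    has_real_derivative_iff_has_vector_derivative
  by (rule vector_derivative_works[THEN iffD1])

lemma partially_differentiableI:
  "((\<lambda>t. f (x(i := t))) has_real_derivative D) (at (x i) within {0..}) \<Longrightarrow> partially_differentiable i f x"
  unfolding partially_differentiable_def
  by (auto simp: real_differentiable_def)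

lemma Ck_partial_at:
  assumes "Ck M (Suc n) f" "x \<in> Xc M" "i \<in> {1..M}"
  shows "((\<lambda>t. f (x(i := t))) has_real_derivative partial i f x) (at (x i) within {0..})"
  using assms by (intro partial_at) auto

lemma Ck_partial_at_upd:
  assumes "Ck M (Suc n) f" "x \<in> Xc M" "i \<in> {1..M}" "t \<ge> 0"
  shows "((\<lambda>s. f (x(i := s))) has_real_derivative partial i f (x(i := t))) (at t within {0..})"
  using Ck_partial_at[OF assms(1) Xc_upd[OF assms(2-4)] assms(3)] by simp

lemma Ck_cont: "Ck M n f \<Longrightarrow> continuous_on (Xc M) f"
  by (cases n) auto

lemma Ck_partial: "Ck M (Suc n) f \<Longrightarrow> i \<in> {1..M} \<Longrightarrow> Ck M n (partial i f)"
  by simp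

lemma Ck_SucI:
  assumes "continuous_on (Xc M) f"
    and "\<And>i x. i \<in> {1..M} \<Longrightarrow> x \<in> Xc M \<Longrightarrow>
      ((\<lambda>t. f (x(i := t))) has_real_derivative f' i x) (at (x i) within {0..})"
    and "\<And>i. i \<in> {1..M} \<Longrightarrow> Ck M n (partial i f)"
  shows "Ck M (Suc n) f"
proof -
  have "partially_differentiable i f x" if "i \<in> {1..M}" "x \<in> Xc M" for i x
    by (rule partially_differentiableI[OF assms(2)[OF that]])
  then show ?thesis using assms(1,3) by simp
qed

text \<open>Slices with \<open>t \<ge> 0\<close> stay in \<open>Xc M\<close> and derivatives are
  taken within \<open>{0..}\<close>, so values off the orthant are invisible. Identities known only
  on \<open>Xc M\<close> can therefore be differentiated again.\<close>

lemma partial_cong: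
  assumes "x \<in> Xc M" "i \<in> {1..M}" "Ck M (Suc n) f" "\<And>y. y \<in> Xc M \<Longrightarrow> f y = g y"
  shows "((\<lambda>t. g (x(i := t))) has_real_derivative partial i f x) (at (x i) within {0..})"
    and "partial i g x = partial i f x"
proof -
  show d: "((\<lambda>t. g (x(i := t))) has_real_derivative partial i f x) (at (x i) within {0..})"
    by (rule has_field_derivative_transform_within[OF Ck_partial_at[OF assms(3,1,2)] zero_less_one])
      (use assms Xc_nonneg Xc_upd in auto)
  show "partial i g x = partial i f x"
    by (rule partial_eqI[OF d Xc_nonneg[OF assms(1)]])
qed

lemma Ck_cong:
  assumes "Ck M n f" "\<And>y. y \<in> Xc M \<Longrightarrow> f y = g y"
  shows "Ck M n g"
  using assms
proof (induction n arbitrary: f g)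
  case 0
  then show ?case by (simp cong: continuous_on_cong)
next
  case (Suc n)
  show ?case
  proof (rule Ck_SucI)
    show "continuous_on (Xc M) g"
      using Suc.prems by (simp cong: continuous_on_cong)
    show "Ck M n (partial i g)" if "i \<in> {1..M}" for i
      by (rule Suc.IH[OF Ck_partial[OF Suc.prems(1) that]])
        (use partial_cong[OF _ that Suc.prems] in auto)
  qed (rule partial_cong[OF _ _ Suc.prems])
qed

lemma partial_diff:
  assumes "x \<in> Xc M" "i \<in> {1..M}" "Ck M (Suc n) f" "Ck M (Suc m) g"
  shows "((\<lambda>t. f (x(i := t)) - g (x(i := t))) has_real_derivative partial i f x - partial i g x)
      (at (x i) within {0..})"
    and "partial i (\<lambda>y. f y - g y) x = partial i f x - partial i g x"
proof -
  show d: "((\<lambda>t. f (x(i := t)) - g (x(i := t))) has_real_derivative partial i f x - partial i g x)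
      (at (x i) within {0..})"
    by (intro DERIV_diff Ck_partial_at[OF assms(3)] Ck_partial_at[OF assms(4)] assms)
  show "partial i (\<lambda>y. f y - g y) x = partial i f x - partial i g x"
    by (rule partial_eqI[OF d Xc_nonneg[OF assms(1)]])
qed

lemma Ck_diff:
  assumes "Ck M n f" "Ck M n g"
  shows "Ck M n (\<lambda>y. f y - g y)"
  using assms
proof (induction n arbitrary: f g)
  case 0
  then show ?case by (auto intro: continuous_on_diff)
next
  case (Suc n)
  show ?case
  proof (rule Ck_SucI)
    show "continuous_on (Xc M) (\<lambda>y. f y - g y)"
      using Suc.prems by (auto intro: continuous_on_diff)
    show "Ck M n (partial i (\<lambda>y. f y - g y))" if "i \<in> {1..M}" for i
      by (rule Ck_cong[OF Suc.IH[OF Ck_partial[OF Suc.prems(1) that] Ck_partial[OF Suc.prems(2) that]]])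
        (use partial_diff(2)[OF _ that Suc.prems] in auto)
  qed (rule partial_diff(1)[OF _ _ Suc.prems])
qed

text \<open>The factor \<open>c\<close> is there for the induction: differentiation divides it by
  \<epsilon> and replaces \<open>g\<close> by \<open>partial i g\<close>, which is again of this
  form.\<close>

lemma Ck_scaled:
  assumes "Ck M n g" "\<epsilon> > 0"
  shows "Ck M n (\<lambda>y. c * g (\<lambda>i. y i / \<epsilon>))"
  using assms(1)
proof (induction n arbitrary: g c)
  have Xc: "(\<lambda>i. y i / \<epsilon>) \<in> Xc M" if "y \<in> Xc M" for y
    using that assms(2) by (auto simp: Xc_def)
  have "continuous_on (Xc M) (\<lambda>y i. y i / \<epsilon>)"
    by (intro continuous_on_coordinatewise_then_product continuous_on_divide continuous_on_const
        continuous_on_subset[OF continuous_on_product_coordinates subset_UNIV]) (use assms(2) in auto)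
  then have cont: "continuous_on (Xc M) (\<lambda>y. c * g (\<lambda>i. y i / \<epsilon>))"
    if "Ck M n g" for n c and g :: "(nat \<Rightarrow> real) \<Rightarrow> real"
    using Xc by (intro continuous_on_mult_left continuous_on_compose2[OF Ck_cont[OF that]]) auto
  {
    case 0
    then show ?case using cont[of 0] by simp
  next
    case (Suc n)
  have d: "((\<lambda>t. c * g (\<lambda>j. (x(i := t)) j / \<epsilon>)) has_real_derivative
      (c / \<epsilon>) * partial i g (\<lambda>j. x j / \<epsilon>)) (at (x i) within {0..})"
    if i: "i \<in> {1..M}" and x: "x \<in> Xc M" for i x
  proof -
    have h1: "((\<lambda>t. g ((\<lambda>j. x j / \<epsilon>)(i := t))) has_real_derivative partial i g (\<lambda>j. x j / \<epsilon>))
        (at (x i / \<epsilon>) within (\<lambda>t. t / \<epsilon>) ` {0..})"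
      by (rule DERIV_subset[OF Ck_partial_at[OF Suc.prems Xc[OF x] i]]) (use assms(2) in auto)
    have h2: "((\<lambda>t. t / \<epsilon>) has_real_derivative 1 / \<epsilon>) (at (x i) within {0..})"
      by (intro DERIV_cdivide DERIV_ident)
    have "((\<lambda>t. g ((\<lambda>j. x j / \<epsilon>)(i := t / \<epsilon>))) has_real_derivative
        partial i g (\<lambda>j. x j / \<epsilon>) * (1 / \<epsilon>)) (at (x i) within {0..})"
      using DERIV_image_chain[OF h1 h2] unfolding o_def .
    moreover have "(\<lambda>j. x j / \<epsilon>)(i := t / \<epsilon>) = (\<lambda>j. (x(i := t)) j / \<epsilon>)" for t
      by auto
    ultimately have "((\<lambda>t. g (\<lambda>j. (x(i := t)) j / \<epsilon>)) has_real_derivative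
        partial i g (\<lambda>j. x j / \<epsilon>) * (1 / \<epsilon>)) (at (x i) within {0..})"
      by simp
    from DERIV_cmult[OF this, of c] show ?thesis by (simp add: mult.commute)
  qed
  show ?case
  proof (rule Ck_SucI)
    show "continuous_on (Xc M) (\<lambda>y. c * g (\<lambda>i. y i / \<epsilon>))"
      by (rule cont[OF Suc.prems])
    show "Ck M n (partial i (\<lambda>y. c * g (\<lambda>i. y i / \<epsilon>)))" if "i \<in> {1..M}" for i
      by (rule Ck_cong[OF Suc.IH[OF Ck_partial[OF Suc.prems that], of "c / \<epsilon>"]])
        (rule partial_eqI[OF d[OF that] Xc_nonneg, symmetric])
  qed (rule d)
  }
qed

lemma Ck_rescale: "Ck M n g \<Longrightarrow> \<epsilon> > 0 \<Longrightarrow> Ck M n (rescale \<epsilon> g)"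
  using Ck_scaled[of M n g \<epsilon> 1] by (simp add: rescale_def)

lemma Ck_pdiff:
  assumes "Ck M (Suc n) f" "j \<in> {1..<M}"
  shows "Ck M n (pdiff j f)"
proof -
  have "pdiff j f = (\<lambda>x. partial j f x - partial (j + 1) f x)"
    by (simp add: pdiff_def fun_eq_iff)
  moreover have "Ck M n \<dots>"
    using assms by (intro Ck_diff Ck_partial) auto
  ultimately show ?thesis by simp
qed

lemma partial_pdiff:
  assumes "Ck M (Suc (Suc n)) f" "j \<in> {1..<M}" "i \<in> {1..M}" "x \<in> Xc M"
  shows "partial i (pdiff j f) x = partial i (partial j f) x - partial i (partial (j + 1) f) x"
proof -
  have "pdiff j f = (\<lambda>x. partial j f x - partial (j + 1) f x)"
    by (simp add: pdiff_def fun_eq_iff)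
  then show ?thesis
    using assms by (auto intro!: partial_diff(2)[of _ M _ n _ n] Ck_partial)
qed

lemma partial_partial_pdiff:
  assumes "Ck M (Suc (Suc (Suc n))) f" "j \<in> {1..<M}" "a \<in> {1..M}" "b \<in> {1..M}" "x \<in> Xc M"
  shows "partial a (partial b (pdiff j f)) x
    = partial a (partial b (partial j f)) x - partial a (partial b (partial (j + 1) f)) x"
proof -
  have C: "Ck M (Suc n) (partial b (partial i f))" if "i \<in> {1..M}" for i
    by (intro Ck_partial assms that)
  have j: "j \<in> {1..M}" "j + 1 \<in> {1..M}" using assms(2) by auto
  have "partial a (partial b (pdiff j f)) x
      = partial a (\<lambda>y. partial b (partial j f) y - partial b (partial (j + 1) f) y) x"
    by (rule partial_cong(2)[OF assms(5,3) Ck_diff[OF C[OF j(1)] C[OF j(2)]]])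
      (rule partial_pdiff[OF assms(1,2,4), symmetric])
  also have "\<dots> = partial a (partial b (partial j f)) x - partial a (partial b (partial (j + 1) f)) x"
    by (rule partial_diff(2)[OF assms(5,3) C C]) (use j in auto)
  finally show ?thesis .
qed

section \<open>The path of a jump across a bond\<close>

text \<open>In coordinates scaled by \<epsilon>, \<open>t = - \<epsilon>\<close> is the jump from
  \<open>j\<close> to \<open>j + 1\<close> and \<open>t = \<epsilon>\<close> the opposite
  one.\<close>

definition shift :: "nat \<Rightarrow> real \<Rightarrow> (nat \<Rightarrow> real) \<Rightarrow> nat \<Rightarrow> real" where
  "shift j t x = x(j := x j + t, j + 1 := x (j + 1) - t)"

lemma shift_Xc:
  assumes "x \<in> Xc M" "j \<in> {1..<M}" "t \<in> {- x j..x (j + 1)}"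
  shows "shift j t x \<in> Xc M"
  using assms by (auto simp: Xc_def shift_def)

text \<open>Chain rule: continuity of the partials gives a total derivative in the coordinates
  \<open>j\<close> and \<open>j + 1\<close> relative to the closed quadrant. The interval for
  \<open>t\<close> is the part of the line inside that quadrant, so boundary points are
  covered.\<close>

lemma shift_deriv:
  assumes f: "Ck M (Suc n) f" and x: "x \<in> Xc M" and j: "j \<in> {1..<M}"
    and t: "t \<in> {- x j..x (j + 1)}"
  shows "((\<lambda>s. f (shift j s x)) has_real_derivative pdiff j f (shift j t x))
    (at t within {- x j..x (j + 1)})"
proof -
  have jM: "j \<in> {1..M}" "j + 1 \<in> {1..M}" using j by auto
  define \<phi> where "\<phi> = (\<lambda>a b. x(j := a, j + 1 := b))"
  have \<phi>: "\<phi> a b \<in> Xc M" if "a \<ge> 0" "b \<ge> 0" for a b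
    unfolding \<phi>_def using that x jM by (intro Xc_upd) auto
  have \<phi>1: "(\<phi> a b)(j := a') = \<phi> a' b" "(\<phi> a b)(j + 1 := b') = \<phi> a b'"
    "\<phi> a b j = a" "\<phi> a b (j + 1) = b" for a b a' b'
    by (auto simp: \<phi>_def)
  define a b where "a = x j + t" and "b = x (j + 1) - t"
  have ab: "a \<ge> 0" "b \<ge> 0" using t by (auto simp: a_def b_def)
  \<comment> \<open>\<open>has_derivative_partialsI\<close> asks for the first partial only at the
    point, but for the second on the whole quadrant, as a bounded linear map continuous at the
    point; hence the asymmetric form.\<close>
  have "((\<lambda>(a, b). f (\<phi> a b)) has_derivative
      (\<lambda>(da, db). partial j f (\<phi> a b) * da + blinfun_mult_right (partial (j + 1) f (\<phi> a b)) db))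
      (at (a, b) within {0..} \<times> {0..})"
  proof (rule has_derivative_partialsI)
    show "((\<lambda>a. f (\<phi> a b)) has_derivative (*) (partial j f (\<phi> a b))) (at a within {0..})"
      using Ck_partial_at[OF f \<phi>[OF ab] jM(1)] by (simp add: \<phi>1 has_field_derivative_def)
    show "((\<lambda>b. f (\<phi> a b)) has_derivative blinfun_mult_right (partial (j + 1) f (\<phi> a b))) (at b within {0..})"
      if "a \<in> {0..}" "b \<in> {0..}" for a b
      using Ck_partial_at[OF f \<phi> jM(2), of a b] that
      unfolding \<phi>1 has_field_derivative_def by simp
    have "continuous_on ({0..} \<times> {0..}) (\<lambda>p. \<phi> (fst p) (snd p))"
    proof (rule continuous_on_coordinatewise_then_product)
      fix i
      consider "i = j + 1" | "i = j" | "i \<noteq> j" "i \<noteq> j + 1" by blast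
      then show "continuous_on ({0..} \<times> {0..}) (\<lambda>p. \<phi> (fst p) (snd p) i)"
        by cases (auto simp: \<phi>_def intro!: continuous_intros)
    qed
    then have "continuous_on ({0..} \<times> {0..}) (\<lambda>p. blinfun_mult_right (partial (j + 1) f (\<phi> (fst p) (snd p))))"
      by (intro bounded_linear.continuous_on[OF bounded_linear_blinfun_mult_right]
          continuous_on_compose2[OF Ck_cont[OF Ck_partial[OF f jM(2)]]]) (auto intro: \<phi>)
    then show "continuous (at (a, b) within {0..} \<times> {0..}) (\<lambda>(a, b). blinfun_mult_right (partial (j + 1) f (\<phi> a b)))"
      using ab by (auto simp: continuous_on_eq_continuous_within case_prod_unfold)
  qed (use ab in auto)
  then have 1: "((\<lambda>(a, b). f (\<phi> a b)) has_derivative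
      (\<lambda>(da, db). partial j f (\<phi> a b) * da + partial (j + 1) f (\<phi> a b) * db))
      (at (a, b) within (\<lambda>s. (x j + s, x (j + 1) - s)) ` {- x j..x (j + 1)})"
    by (auto intro: has_derivative_subset)
  have 2: "((\<lambda>s. (x j + s, x (j + 1) - s)) has_derivative (\<lambda>s. (s, - s))) (at t within {- x j..x (j + 1)})"
    by (auto intro!: derivative_eq_intros)
  have "((\<lambda>s. f (\<phi> (x j + s) (x (j + 1) - s))) has_derivative
      (\<lambda>s. partial j f (\<phi> a b) * s + partial (j + 1) f (\<phi> a b) * (- s))) (at t within {- x j..x (j + 1)})"
    using has_derivative_in_compose[OF 2 1[unfolded a_def b_def]]
    by (simp add: case_prod_unfold a_def b_def)
  moreover have "(\<lambda>s. partial j f (\<phi> a b) * s + partial (j + 1) f (\<phi> a b) * (- s))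
      = (*) (pdiff j f (\<phi> a b))"
    by (simp add: pdiff_def fun_eq_iff left_diff_distrib)
  ultimately show ?thesis
    unfolding has_field_derivative_def shift_def by (simp add: \<phi>_def a_def b_def)
qed

section \<open>Sup-norm boxes, mean value and Taylor estimates\<close>

definition orthant_box :: "nat \<Rightarrow> real \<Rightarrow> (nat \<Rightarrow> real) \<Rightarrow> (nat \<Rightarrow> real) set" where
  "orthant_box M r x = {y \<in> Xc M. \<forall>i\<in>{1..M}. \<bar>y i - x i\<bar> \<le> r}"

text \<open>The Euclidean norm is at most the sum of the absolute coordinates, and
  \<open>M / (M + 1) < 1\<close>; the added 1 gives strictness and covers
  \<open>M = 0\<close>.\<close>

lemma box_subset_nbhd:
  assumes "r > 0"
  shows "orthant_box M (r / (real M + 1)) x \<subseteq> nbhd M r x"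
proof
  fix y assume y: "y \<in> orthant_box M (r / (real M + 1)) x"
  have "L2_set (\<lambda>i. y i - x i) {1..M} \<le> (\<Sum>i=1..M. \<bar>y i - x i\<bar>)"
    by (rule L2_set_le_sum_abs)
  also have "\<dots> \<le> (\<Sum>i=1..M. r / (real M + 1))"
    using y by (intro sum_mono) (auto simp: orthant_box_def)
  also have "\<dots> < r"
    using assms by (simp add: field_simps)
  finally show "y \<in> nbhd M r x"
    using y by (simp add: nbhd_def orthant_box_def)
qed

text \<open>Coordinates of \<open>x\<close> are replaced by those of \<open>y\<close> one at a time;
  each replacement costs at most \<open>K * d\<close> by the one-dimensional mean value
  inequality.\<close>

lemma box_lipschitz:
  assumes f: "Ck M (Suc n) f" and x: "x \<in> Xc M" and y: "y \<in> orthant_box M d x" and d: "d \<le> r"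
    and K: "\<And>i z. i \<in> {1..M} \<Longrightarrow> z \<in> orthant_box M r x \<Longrightarrow> \<bar>partial i f z\<bar> \<le> K"
  shows "\<bar>f y - f x\<bar> \<le> real M * (K * d)"
proof -
  \<comment> \<open>\<open>z J\<close> agrees with \<open>y\<close> on \<open>J\<close> and with
    \<open>x\<close> elsewhere, so \<open>z {1..m}\<close> runs from \<open>x\<close> to
    \<open>y\<close>.\<close>
  define z where "z = (\<lambda>J i. if i \<in> J then y i else x i)"
  have yX: "y \<in> Xc M" using y by (simp add: orthant_box_def)
  have "\<bar>f (z {1..m}) - f x\<bar> \<le> real m * (K * d)" if "m \<le> M" for m
    using that
  proof (induction m)
    case 0
    then show ?case by (simp add: z_def)
  next
    case (Suc m)
    let ?i = "Suc m"
    have i: "?i \<in> {1..M}" using Suc.prems by auto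
    have zX: "z {1..m} \<in> Xc M" using x yX by (auto simp: Xc_def z_def)
    have eq: "z {1..?i} = (z {1..m})(?i := y ?i)" "z {1..m} = (z {1..m})(?i := x ?i)"
      by (auto simp: z_def)
    have "norm (f ((z {1..m})(?i := y ?i)) - f ((z {1..m})(?i := x ?i))) \<le> K * norm (y ?i - x ?i)"
    proof (rule field_differentiable_bound[of "closed_segment (x ?i) (y ?i)"])
      fix t assume t: "t \<in> closed_segment (x ?i) (y ?i)"
      then have t0: "t \<ge> 0" and td: "\<bar>t - x ?i\<bar> \<le> \<bar>y ?i - x ?i\<bar>"
        using Xc_nonneg[OF x, of ?i] Xc_nonneg[OF yX, of ?i]
        by (auto simp: closed_segment_eq_real_ivl split: if_splits)
      show "((\<lambda>t. f ((z {1..m})(?i := t))) has_real_derivative partial ?i f ((z {1..m})(?i := t)))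
          (at t within closed_segment (x ?i) (y ?i))"
        by (rule DERIV_subset[OF Ck_partial_at_upd[OF f zX i t0]])
          (use Xc_nonneg[OF x, of ?i] Xc_nonneg[OF yX, of ?i] in
            \<open>auto simp: closed_segment_eq_real_ivl split: if_splits\<close>)
      have "\<bar>t - x ?i\<bar> \<le> d" using td y i by (force simp: orthant_box_def)
      then have "(z {1..m})(?i := t) \<in> orthant_box M r x"
        using Xc_upd[OF zX i t0] y d i by (force simp: orthant_box_def z_def)
      then show "norm (partial ?i f ((z {1..m})(?i := t))) \<le> K"
        using K i by simp
    qed auto
    also have "\<dots> \<le> K * d"
    proof (rule mult_left_mono)
      show "norm (y ?i - x ?i) \<le> d" using y i by (auto simp: orthant_box_def)
      then have "x \<in> orthant_box M r x" using x d by (auto simp: orthant_box_def)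
      then show "0 \<le> K" using K[OF i] by (meson abs_ge_zero order_trans)
    qed
    finally have "\<bar>f (z {1..?i}) - f (z {1..m})\<bar> \<le> K * d"
      using eq by simp
    with Suc show ?case by (auto simp: distrib_right)
  qed
  from this[of M] have "\<bar>f (z {1..M}) - f x\<bar> \<le> real M * (K * d)" by simp
  moreover have "z {1..M} = y"
    using x yX by (auto simp: z_def Xc_def fun_eq_iff)
  ultimately show ?thesis by simp
qed

text \<open>
  Comparing with a point at the fixed distance \<open>r\<close> in an inward direction turns bounds on values and
  on second derivatives into a bound on the first derivative at \<open>x\<close>.
\<close>

lemma partial_bound_by_increment:
  assumes u: "Ck M (Suc (Suc n)) u" and x: "x \<in> Xc M" and i: "i \<in> {1..M}" and r: "r > 0"
    and K: "\<And>z. z \<in> orthant_box M r x \<Longrightarrow> \<bar>partial i (partial i u) z\<bar> \<le> K"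
  shows "\<bar>partial i u x\<bar> \<le> \<bar>u (x(i := x i + r)) - u x\<bar> / r + K * r"
proof -
  \<comment> \<open>\<open>h\<close> lists the slice and its first two derivatives, as
    \<open>field_Taylor\<close> expects; the remainder there is divided by \<open>fact 1\<close>,
    hence \<open>K * r\<close> without a factor 1/2.\<close>
  define h where "h = (\<lambda>m::nat. \<lambda>t. (if m = 0 then u else if m = 1 then partial i u else partial i (partial i u)) (x(i := t)))"
  have x0: "x i \<ge> 0" by (rule Xc_nonneg[OF x])
  have "norm (h 0 (x i + r) - (\<Sum>m\<le>1. h m (x i) * (x i + r - x i) ^ m / fact m))
      \<le> K * norm (x i + r - x i) ^ Suc 1 / fact 1"
  proof (rule field_Taylor[of "{x i..x i + r}"])
    fix m t assume t: "t \<in> {x i..x i + r}" and m: "m \<le> (1::nat)"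
    have t0: "t \<ge> 0" using t x0 by auto
    have sub: "{x i..x i + r} \<subseteq> {0..}" using x0 by auto
    have "m = 0 \<or> m = 1" using m by auto
    then show "(h m has_real_derivative h (Suc m) t) (at t within {x i..x i + r})"
      using DERIV_subset[OF Ck_partial_at_upd[OF u x i t0] sub]
        DERIV_subset[OF Ck_partial_at_upd[OF Ck_partial[OF u i] x i t0] sub]
      by (elim disjE) (simp_all add: h_def)
  next
    fix t assume t: "t \<in> {x i..x i + r}"
    then have "x(i := t) \<in> orthant_box M r x"
      using Xc_upd[OF x i, of t] x0 r by (auto simp: orthant_box_def)
    then show "norm (h (Suc 1) t) \<le> K"
      using K by (simp add: h_def)
  qed (use r in auto)
  then have "\<bar>u (x(i := x i + r)) - u x - partial i u x * r\<bar> \<le> K * r\<^sup>2"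
    using r by (simp add: h_def power2_eq_square algebra_simps)
  then have "\<bar>partial i u x\<bar> * r \<le> \<bar>u (x(i := x i + r)) - u x\<bar> + K * r\<^sup>2"
    using r abs_mult[of "partial i u x" r] by auto
  then have "\<bar>partial i u x\<bar> \<le> (\<bar>u (x(i := x i + r)) - u x\<bar> + K * r\<^sup>2) / r"
    using r by (simp add: pos_le_divide_eq)
  also have "\<dots> = \<bar>u (x(i := x i + r)) - u x\<bar> / r + K * r"
    using r by (simp add: field_simps power2_eq_square)
  finally show ?thesis .
qed

text \<open>By \<open>shift_deriv\<close> the iterates of \<open>pdiff j\<close> are the successive
  derivatives along the path, so Taylor's formula in one variable applies. The constant is generous:
  the factor 1/2 of the remainder is dropped.\<close>

lemma shift_Taylor:
  assumes g: "Ck M (Suc (Suc (Suc n))) g" and y: "y \<in> Xc M" and j: "j \<in> {1..<M}"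
    and t: "t \<in> {- y j..y (j + 1)}"
    and K: "\<And>s. s \<in> closed_segment 0 t \<Longrightarrow> \<bar>pdiff j (pdiff j (pdiff j g)) (shift j s y)\<bar> \<le> K"
  shows "\<bar>g (shift j t y) - g y - t * pdiff j g y - t\<^sup>2 / 2 * pdiff j (pdiff j g) y\<bar> \<le> K * \<bar>t\<bar> ^ 3"
proof -
  define h where "h = (\<lambda>m s. ((pdiff j ^^ m) g) (shift j s y))"
  have sub: "closed_segment 0 t \<subseteq> {- y j..y (j + 1)}"
    using t Xc_nonneg[OF y, of j] Xc_nonneg[OF y, of "j + 1"]
    by (auto simp: closed_segment_eq_real_ivl split: if_splits)
  have y0: "shift j 0 y = y" by (simp add: shift_def)
  have "norm (h 0 t - (\<Sum>m\<le>2. h m 0 * (t - 0) ^ m / fact m)) \<le> K * norm (t - 0) ^ Suc 2 / fact 2"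
  proof (rule field_Taylor[of "closed_segment 0 t"])
    fix m s assume s: "s \<in> closed_segment 0 t" and m: "m \<le> (2::nat)"
    have "m = 0 \<or> m = 1 \<or> m = 2" using m by auto
    then obtain l where "Ck M (Suc l) ((pdiff j ^^ m) g)"
    proof (elim disjE)
      show "m = 0 \<Longrightarrow> ?thesis" using that[of "Suc (Suc n)"] g by simp
      show "m = 1 \<Longrightarrow> ?thesis" using that[of "Suc n"] Ck_pdiff[OF g j] by simp
      show "m = 2 \<Longrightarrow> ?thesis"
        using that[of n] Ck_pdiff[OF Ck_pdiff[OF g j] j] by (simp add: numeral_2_eq_2 del: Ck.simps)
    qed
    from DERIV_subset[OF shift_deriv[OF this y j subsetD[OF sub s]] sub]
    show "(h m has_real_derivative h (Suc m) s) (at s within closed_segment 0 t)"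
      unfolding h_def by simp
  next
    show "norm (h (Suc 2) s) \<le> K" if "s \<in> closed_segment 0 t" for s
      using K[OF that] by (simp add: h_def numeral_2_eq_2)
  qed auto
  also have "\<dots> \<le> K * \<bar>t\<bar> ^ 3"
  proof -
    have "0 \<le> K" using K[of 0] by (meson abs_ge_zero ends_in_segment(1) order_trans)
    then have "0 \<le> K * \<bar>t\<bar> ^ 3" by simp
    moreover have "\<bar>t\<bar> ^ Suc 2 = \<bar>t\<bar> ^ 3" by (simp only: eval_nat_numeral)
    ultimately show ?thesis by simp
  qed
  finally show ?thesis
    by (simp add: h_def numeral_2_eq_2 y0 algebra_simps)
qed

section \<open>Uniform bounds and limits at moving points\<close>

lemma finite_common_bound:
  assumes "finite I" "\<And>i. i \<in> I \<Longrightarrow> \<exists>K::real. P i K" "\<And>i K K'. P i K \<Longrightarrow> K \<le> K' \<Longrightarrow> P i K'"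
  shows "\<exists>K. \<forall>i\<in>I. P i K"
  using assms(1,2)
proof (induction I)
  case (insert a I)
  then obtain K K' where "\<forall>i\<in>I. P i K" "P a K'" by (meson insert_iff)
  then have "\<forall>i\<in>insert a I. P i (max K K')"
    using assms(3) by (metis insert_iff max.cobounded1 max.cobounded2)
  then show ?case by blast
qed auto

text \<open>Each \<open>pdiff j\<close> is a difference of two partials and doubles the bound, hence
  2, 4, 8. The three bounds control, in turn, the gradient of the first directional derivative, that
  of the second, and the Taylor remainder.\<close>

lemma third_directional_bounds:
  assumes g: "Ck M (Suc (Suc (Suc n))) g" and j: "j \<in> {1..<M}" and y: "y \<in> Xc M"
    and K: "\<And>a b c. a \<in> {1..M} \<Longrightarrow> b \<in> {1..M} \<Longrightarrow> c \<in> {1..M} \<Longrightarrow>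
      \<bar>partial a (partial b (partial c g)) y\<bar> \<le> K"
  shows "\<And>a b. a \<in> {1..M} \<Longrightarrow> b \<in> {1..M} \<Longrightarrow> \<bar>partial a (partial b (pdiff j g)) y\<bar> \<le> 2 * K"
    and "\<And>a. a \<in> {1..M} \<Longrightarrow> \<bar>partial a (pdiff j (pdiff j g)) y\<bar> \<le> 4 * K"
    and "\<bar>pdiff j (pdiff j (pdiff j g)) y\<bar> \<le> 8 * K"
proof -
  have jM: "j \<in> {1..M}" "j + 1 \<in> {1..M}" using j by auto
  show 1: "\<bar>partial a (partial b (pdiff j g)) y\<bar> \<le> 2 * K" if "a \<in> {1..M}" "b \<in> {1..M}" for a b
    unfolding partial_partial_pdiff[OF g j that y] using K[OF that jM(1)] K[OF that jM(2)] by linarith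
  show 2: "\<bar>partial a (pdiff j (pdiff j g)) y\<bar> \<le> 4 * K" if "a \<in> {1..M}" for a
    unfolding partial_pdiff[OF Ck_pdiff[OF g j] j that y] using 1[OF that jM(1)] 1[OF that jM(2)] by linarith
  show "\<bar>pdiff j (pdiff j (pdiff j g)) y\<bar> \<le> 8 * K"
    using 2[OF jM(1)] 2[OF jM(2)] unfolding pdiff_def[of j "pdiff j (pdiff j g)"] by linarith
qed

text \<open>With a gradient bounded on a fixed box, passing from \<open>x\<close> to
  \<open>Y \<epsilon>\<close> costs \<open>O(\<epsilon>)\<close>.\<close>

lemma tendsto_moving_point:
  assumes x: "x \<in> Xc M" and r: "r > 0"
    and h: "\<forall>\<^sub>F \<epsilon> in at_right 0. Ck M (Suc n) (h \<epsilon>) \<and>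
      (\<forall>i\<in>{1..M}. \<forall>z\<in>orthant_box M r x. \<bar>partial i (h \<epsilon>) z\<bar> \<le> K)"
    and Y: "\<forall>\<^sub>F \<epsilon> in at_right 0. Y \<epsilon> \<in> orthant_box M \<epsilon> x"
    and lim: "((\<lambda>\<epsilon>. h \<epsilon> x) \<longlongrightarrow> L) (at_right 0)"
  shows "((\<lambda>\<epsilon>. h \<epsilon> (Y \<epsilon>)) \<longlongrightarrow> L) (at_right (0::real))"
proof -
  have "\<forall>\<^sub>F \<epsilon> in at_right 0. \<epsilon> < r"
    using r by (simp add: eventually_at_right_real eventually_at_right_field) (use r in blast)
  then have "\<forall>\<^sub>F \<epsilon> in at_right 0. norm (h \<epsilon> (Y \<epsilon>) - h \<epsilon> x) \<le> real M * (K * \<epsilon>)"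
    using h Y
  proof eventually_elim
    case (elim \<epsilon>)
    then show ?case
      using box_lipschitz[of M n "h \<epsilon>" x "Y \<epsilon>" \<epsilon> r K] x by simp
  qed
  moreover have "((\<lambda>\<epsilon>. real M * (K * \<epsilon>)) \<longlongrightarrow> real M * (K * 0)) (at_right 0)"
    by (intro tendsto_intros)
  ultimately have "((\<lambda>\<epsilon>. h \<epsilon> (Y \<epsilon>) - h \<epsilon> x) \<longlongrightarrow> 0) (at_right 0)"
    by (intro Lim_null_comparison[of "\<lambda>\<epsilon>. h \<epsilon> (Y \<epsilon>) - h \<epsilon> x"]) auto
  from tendsto_add[OF this lim] show ?thesis by simp
qed

text \<open>At \<open>x\<close> the bound comes from the increment of \<open>u\<close> to a second
  point, which converges and so is eventually bounded. It spreads over the box by the mean value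
  inequality for \<open>partial i u\<close>.\<close>

lemma gradient_eventually_bounded:
  assumes x: "x \<in> Xc M" and r: "r > 0"
    and u: "\<forall>\<^sub>F \<epsilon> in at_right 0. Ck M (Suc (Suc n)) (u \<epsilon>) \<and>
      (\<forall>a\<in>{1..M}. \<forall>b\<in>{1..M}. \<forall>z\<in>orthant_box M r x. \<bar>partial a (partial b (u \<epsilon>)) z\<bar> \<le> K)"
    and lim: "\<And>z. z \<in> Xc M \<Longrightarrow> ((\<lambda>\<epsilon>. u \<epsilon> z) \<longlongrightarrow> L z) (at_right (0::real))"
  shows "\<exists>K'. \<forall>\<^sub>F \<epsilon> in at_right 0. \<forall>i\<in>{1..M}. \<forall>z\<in>orthant_box M r x. \<bar>partial i (u \<epsilon>) z\<bar> \<le> K'"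
proof -
  have "\<exists>K'. \<forall>i\<in>{1..M}. \<forall>\<^sub>F \<epsilon> in at_right 0. \<forall>z\<in>orthant_box M r x. \<bar>partial i (u \<epsilon>) z\<bar> \<le> K'"
  proof (rule finite_common_bound)
    fix i assume i: "i \<in> {1..M}"
    \<comment> \<open>Increasing a coordinate never leaves the orthant, so this comparison point is
      available even for \<open>x\<close> on the boundary.\<close>
    define x' where "x' = x(i := x i + r)"
    have x': "x' \<in> Xc M"
      unfolding x'_def using Xc_upd[OF x i] Xc_nonneg[OF x, of i] r by simp
    have "((\<lambda>\<epsilon>. \<bar>u \<epsilon> x' - u \<epsilon> x\<bar>) \<longlongrightarrow> \<bar>L x' - L x\<bar>) (at_right 0)"
      by (intro tendsto_intros lim x x')
    then have "\<forall>\<^sub>F \<epsilon> in at_right 0. \<bar>u \<epsilon> x' - u \<epsilon> x\<bar> < \<bar>L x' - L x\<bar> + 1"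
      by (rule order_tendstoD) simp
    with u have "\<forall>\<^sub>F \<epsilon> in at_right 0. \<forall>z\<in>orthant_box M r x.
        \<bar>partial i (u \<epsilon>) z\<bar> \<le> (\<bar>L x' - L x\<bar> + 1) / r + K * r + real M * (K * r)"
    proof eventually_elim
      case (elim \<epsilon>)
      then have C: "Ck M (Suc (Suc n)) (u \<epsilon>)" by blast
      have "\<bar>partial i (u \<epsilon>) x\<bar> \<le> \<bar>u \<epsilon> x' - u \<epsilon> x\<bar> / r + K * r"
        unfolding x'_def by (rule partial_bound_by_increment[OF C x i r]) (use elim i in blast)
      also have "\<dots> \<le> (\<bar>L x' - L x\<bar> + 1) / r + K * r"
        using elim r by (intro add_right_mono divide_right_mono) auto
      finally have 1: "\<bar>partial i (u \<epsilon>) x\<bar> \<le> (\<bar>L x' - L x\<bar> + 1) / r + K * r" .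
      show ?case
      proof
        fix z assume z: "z \<in> orthant_box M r x"
        have "\<bar>partial i (u \<epsilon>) z - partial i (u \<epsilon>) x\<bar> \<le> real M * (K * r)"
          by (rule box_lipschitz[OF Ck_partial[OF C i] x z order_refl]) (use elim i in blast)
        with 1 show "\<bar>partial i (u \<epsilon>) z\<bar> \<le> (\<bar>L x' - L x\<bar> + 1) / r + K * r + real M * (K * r)"
          by linarith
      qed
    qed
    then show "\<exists>K'. \<forall>\<^sub>F \<epsilon> in at_right 0. \<forall>z\<in>orthant_box M r x. \<bar>partial i (u \<epsilon>) z\<bar> \<le> K'" by blast
  next
    fix i and K K' :: real
    assume "\<forall>\<^sub>F \<epsilon> in at_right 0. \<forall>z\<in>orthant_box M r x. \<bar>partial i (u \<epsilon>) z\<bar> \<le> K" "K \<le> K'"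
    then show "\<forall>\<^sub>F \<epsilon> in at_right 0. \<forall>z\<in>orthant_box M r x. \<bar>partial i (u \<epsilon>) z\<bar> \<le> K'"
      by (auto elim!: eventually_mono intro: order_trans)
  qed simp
  then show ?thesis by (simp add: eventually_ball_finite_distrib)
qed

section \<open>Asymptotics of the jump rates\<close>

text \<open>
  \<open>Y\<close> is a perturbation of \<open>X\<close> of the form \<open>X + \<theta> d + o(\<theta>)\<close>. A derivative in \<open>\<theta>\<close> does not
  make sense here, because \<open>X\<close> itself jumps with \<open>\<epsilon>\<close> through the floor function.
\<close>

definition first_order :: "'a filter \<Rightarrow> ('a \<Rightarrow> real) \<Rightarrow> ('a \<Rightarrow> real) \<Rightarrow> ('a \<Rightarrow> real) \<Rightarrow> real \<Rightarrow> real \<Rightarrow> bool" where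
  "first_order \<F> \<theta> X Y x d \<longleftrightarrow>
     (X \<longlongrightarrow> x) \<F> \<and> (Y \<longlongrightarrow> x) \<F> \<and> ((\<lambda>e. (Y e - X e) / \<theta> e) \<longlongrightarrow> d) \<F>"

section \<open>Rules for first-order perturbations\<close>

lemma first_order_const: "(X \<longlongrightarrow> x) \<F> \<Longrightarrow> first_order \<F> \<theta> X X x 0"
  by (simp add: first_order_def)

lemma first_order_eqI: "first_order \<F> \<theta> X Y x d \<Longrightarrow> d = d' \<Longrightarrow> first_order \<F> \<theta> X Y x d'"
  by simp

text \<open>Product rule, from \<open>Y Y' - X X' = Y (Y' - X') + (Y - X) X'\<close>.\<close>

lemma first_order_mult:
  assumes "first_order \<F> \<theta> X Y x d" "first_order \<F> \<theta> X' Y' x' d'"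
  shows "first_order \<F> \<theta> (\<lambda>e. X e * X' e) (\<lambda>e. Y e * Y' e) (x * x') (x * d' + d * x')"
proof -
  have "((\<lambda>e. Y e * ((Y' e - X' e) / \<theta> e) + (Y e - X e) / \<theta> e * X' e) \<longlongrightarrow> x * d' + d * x') \<F>"
    using assms unfolding first_order_def by (intro tendsto_intros) auto
  moreover have "Y e * ((Y' e - X' e) / \<theta> e) + (Y e - X e) / \<theta> e * X' e
      = (Y e * Y' e - X e * X' e) / \<theta> e" for e
    by (simp add: algebra_simps flip: add_divide_distrib)
  ultimately show ?thesis
    using assms unfolding first_order_def by (auto intro: tendsto_mult)
qed

lemma first_order_inverse:
  assumes "first_order \<F> \<theta> X Y x d" "x \<noteq> 0"
  shows "first_order \<F> \<theta> (\<lambda>e. inverse (X e)) (\<lambda>e. inverse (Y e)) (inverse x) (- d / x\<^sup>2)"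
proof -
  have X: "(X \<longlongrightarrow> x) \<F>" and Y: "(Y \<longlongrightarrow> x) \<F>"
    and d: "((\<lambda>e. (Y e - X e) / \<theta> e) \<longlongrightarrow> d) \<F>"
    using assms(1) unfolding first_order_def by simp_all
  have "((\<lambda>e. (inverse (Y e) - inverse (X e)) / \<theta> e) \<longlongrightarrow> - d / x\<^sup>2) \<F>"
  proof (rule Lim_transform_eventually)
    show "((\<lambda>e. - ((Y e - X e) / \<theta> e) / (X e * Y e)) \<longlongrightarrow> - d / x\<^sup>2) \<F>"
      unfolding power2_eq_square by (intro tendsto_intros X Y d) (simp add: assms(2))
    show "\<forall>\<^sub>F e in \<F>. - ((Y e - X e) / \<theta> e) / (X e * Y e) = (inverse (Y e) - inverse (X e)) / \<theta> e"
      using tendsto_imp_eventually_ne[OF X assms(2)] tendsto_imp_eventually_ne[OF Y assms(2)]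
    proof eventually_elim
      case (elim e)
      then have "inverse (Y e) - inverse (X e) = - (Y e - X e) / (X e * Y e)"
        by (simp add: inverse_diff_inverse divide_inverse algebra_simps)
      then show ?case by (simp add: mult.commute minus_divide_left)
    qed
  qed
  then show ?thesis
    unfolding first_order_def using tendsto_inverse[OF X assms(2)] tendsto_inverse[OF Y assms(2)] by simp
qed

text \<open>The addition theorem expresses the increment by difference quotients of
  \<open>cosh\<close> and \<open>sinh\<close> at 0 in \<theta> alone, so nothing but convergence is
  asked of \<open>u\<close>.\<close>

lemma first_order_sinh:
  assumes u: "(u \<longlongrightarrow> u0) \<F>" and \<theta>: "filterlim \<theta> (at 0) \<F>"
  shows "first_order \<F> \<theta> (\<lambda>e. sinh (u e)) (\<lambda>e. sinh (u e + c * \<theta> e)) (sinh u0) (c * cosh u0)"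
proof -
  have \<theta>0: "(\<theta> \<longlongrightarrow> 0) \<F>" using \<theta> by (simp add: filterlim_at)
  have "((\<lambda>t. cosh (c * t)) has_real_derivative 0) (at 0)"
    "((\<lambda>t. sinh (c * t)) has_real_derivative c) (at 0)"
    by (auto intro!: derivative_eq_intros)
  then have "((\<lambda>t. (cosh (c * t) - 1) / t) \<longlongrightarrow> 0) (at 0)" "((\<lambda>t. sinh (c * t) / t) \<longlongrightarrow> c) (at 0)"
    by (simp_all add: DERIV_def)
  then have l: "((\<lambda>e. (cosh (c * \<theta> e) - 1) / \<theta> e) \<longlongrightarrow> 0) \<F>" "((\<lambda>e. sinh (c * \<theta> e) / \<theta> e) \<longlongrightarrow> c) \<F>"
    using \<theta> by (auto intro: filterlim_compose)
  have "((\<lambda>e. sinh (u e) * ((cosh (c * \<theta> e) - 1) / \<theta> e) + cosh (u e) * (sinh (c * \<theta> e) / \<theta> e))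
      \<longlongrightarrow> sinh u0 * 0 + cosh u0 * c) \<F>"
    by (intro tendsto_intros u l)
  moreover have "sinh (u e) * ((cosh (c * \<theta> e) - 1) / \<theta> e) + cosh (u e) * (sinh (c * \<theta> e) / \<theta> e)
      = (sinh (u e + c * \<theta> e) - sinh (u e)) / \<theta> e" for e
    by (simp add: sinh_add algebra_simps flip: add_divide_distrib diff_divide_distrib)
  moreover have "((\<lambda>e. sinh (u e + c * \<theta> e)) \<longlongrightarrow> sinh (u0 + c * 0)) \<F>"
    by (intro tendsto_intros u \<theta>0)
  ultimately show ?thesis
    using u unfolding first_order_def by (auto intro: tendsto_sinh simp: mult.commute)
qed

section \<open>The rates in terms of hyperbolic sines\<close>

text \<open>Write \<open>q powr a\<close> as \<open>exp (a * ln q)\<close>. The sign in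
  \<open>- ln q\<close> is chosen so that for \<open>q = 1 - \<epsilon> * \<sigma>\<close> it
  behaves like \<open>\<epsilon> * \<sigma>\<close>. At \<open>q = 1\<close> both sides are 0 by the
  convention for division by 0.\<close>

lemma qnum_sinh:
  assumes "q > 0"
  shows "qnum q a = sinh (- ln q * a) / sinh (- ln q)"
proof -
  have e: "q powr a - q powr - a = - 2 * sinh (- ln q * a)" for a
    using assms by (simp add: powr_def sinh_def mult.commute)
  show ?thesis
    unfolding qnum_def using e[of a] e[of 1] assms by simp
qed

text \<open>Each argument is a combination of \<open>a\<close>, \<open>b\<close>, \<open>H\<close>
  plus a constant times \<theta>, the form taken by \<open>first_order_sinh\<close>; hence terms
  like \<open>(- 1) * \<theta>\<close>. An empty departing site is absorbed by
  \<open>sinh a = 0\<close>.\<close>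

lemma rate_plus_eq:
  assumes q: "q > 0" "q \<noteq> 1" and j: "j \<ge> 1" and \<theta>: "\<theta> = - ln q"
    and a: "a = \<theta> * real (\<zeta> j)" and b: "b = \<theta> * real (\<zeta> (j+1))" and H: "H = \<theta> * hminus k lam \<zeta> j"
  shows "rate_plus q k lam \<zeta> j =
    sinh a * sinh (b + k (j+1) * \<theta>) * sinh (H - a + (- k j) * \<theta>) * sinh (H + b)
      * inverse (sinh (H + (- 1) * \<theta>)) * inverse (sinh H) / (sinh \<theta>)\<^sup>2"
proof -
  \<comment> \<open>Subtraction is truncated: \<open>j - 1\<close> is the preceding site only for
    positive \<open>j\<close>.\<close>
  obtain i where i: "j = Suc i" using j by (cases j) auto
  have h: "hminus k lam \<zeta> (j-1) = hminus k lam \<zeta> j - 2 * real (\<zeta> j) - k j"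
    by (simp add: hminus_def i)
  have arg: "\<theta> * (hminus k lam \<zeta> (j-1) + real (\<zeta> j)) = H - a + (- k j) * \<theta>"
    "\<theta> * (real (\<zeta> (j+1)) + k (j+1)) = b + k (j+1) * \<theta>"
    "\<theta> * (hminus k lam \<zeta> j + real (\<zeta> (j+1))) = H + b"
    "\<theta> * (hminus k lam \<zeta> j - 1) = H + (- 1) * \<theta>"
    unfolding h a b H by (auto simp: algebra_simps)
  have s: "sinh \<theta> \<noteq> 0" using q \<theta> by simp
  show ?thesis
    unfolding rate_plus_def qnum_sinh[OF q(1)] \<theta>[symmetric] arg
      a[symmetric] H[symmetric]
    using s by (simp add: a field_simps power2_eq_square)
qed

text \<open>In the same \<open>a\<close>, \<open>b\<close>, \<open>H\<close> the leading factors
  agree with those of the opposite jump, and only the multiples of \<theta> differ. An empty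
  departing site is absorbed by \<open>sinh b = 0\<close>.\<close>

lemma rate_minus_eq:
  assumes q: "q > 0" "q \<noteq> 1" and \<theta>: "\<theta> = - ln q"
    and a: "a = \<theta> * real (\<zeta> j)" and b: "b = \<theta> * real (\<zeta> (j+1))" and H: "H = \<theta> * hminus k lam \<zeta> j"
  shows "rate_minus q k lam \<zeta> (j+1) =
    sinh (a + k j * \<theta>) * sinh b * sinh (H - a) * sinh (H + b + k (j+1) * \<theta>)
      * inverse (sinh (H + 1 * \<theta>)) * inverse (sinh H) / (sinh \<theta>)\<^sup>2"
proof -
  have h: "hminus k lam \<zeta> (j+1) = hminus k lam \<zeta> j + 2 * real (\<zeta> (j+1)) + k (j+1)"
    by (simp add: hminus_def)
  have arg: "\<theta> * (hminus k lam \<zeta> (j+1) - real (\<zeta> (j+1))) = H + b + k (j+1) * \<theta>"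
    "\<theta> * (real (\<zeta> j) + k j) = a + k j * \<theta>"
    "\<theta> * (hminus k lam \<zeta> j - real (\<zeta> j)) = H - a"
    "\<theta> * (hminus k lam \<zeta> j + 1) = H + 1 * \<theta>"
    unfolding h a b H by (auto simp: algebra_simps)
  have s: "sinh \<theta> \<noteq> 0" using q \<theta> by simp
  show ?thesis
    unfolding rate_minus_def qnum_sinh[OF q(1)] \<theta>[symmetric] add_diff_cancel_right' arg
      b[symmetric] H[symmetric]
    using s by (simp add: b field_simps power2_eq_square)
qed

text \<open>Everything follows from \<theta> having derivative \<sigma> at 0 and from
  \<open>sinh t / t\<close> tending to 1. As \<theta> is nonzero for small positive \<epsilon>,
  limits at 0 can be composed with it.\<close>

lemma deformation_limits:
  fixes \<sigma> :: real
  assumes "\<sigma> \<noteq> 0" and \<theta>_def: "\<theta> = (\<lambda>\<epsilon>. - ln (1 - \<epsilon> * \<sigma>))"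
  shows "\<forall>\<^sub>F \<epsilon> in at_right 0. 1 - \<epsilon> * \<sigma> > 0 \<and> 1 - \<epsilon> * \<sigma> \<noteq> 1"
    and "filterlim \<theta> (at 0) (at_right 0)"
    and "((\<lambda>\<epsilon>. \<theta> \<epsilon> / \<epsilon>) \<longlongrightarrow> \<sigma>) (at_right 0)"
    and "((\<lambda>\<epsilon>. \<epsilon> / sinh (\<theta> \<epsilon>)) \<longlongrightarrow> 1 / \<sigma>) (at_right 0)"
    and "((\<lambda>\<epsilon>. \<theta> \<epsilon> / sinh (\<theta> \<epsilon>)) \<longlongrightarrow> 1) (at_right 0)"
proof -
  have "((\<lambda>\<epsilon>. 1 - \<epsilon> * \<sigma>) \<longlongrightarrow> 1 - 0 * \<sigma>) (at_right 0)"
    by (intro tendsto_intros)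
  then have "\<forall>\<^sub>F \<epsilon> in at_right 0. 1 - \<epsilon> * \<sigma> > 0"
    by (rule order_tendstoD) simp
  with eventually_at_right_less[of 0]
  show e: "\<forall>\<^sub>F \<epsilon> in at_right 0. 1 - \<epsilon> * \<sigma> > 0 \<and> 1 - \<epsilon> * \<sigma> \<noteq> 1"
    by eventually_elim (use assms(1) in auto)
  from e have ne: "\<forall>\<^sub>F \<epsilon> in at_right 0. \<theta> \<epsilon> \<noteq> 0"
    by eventually_elim (simp add: \<theta>_def)
  have D: "(\<theta> has_real_derivative \<sigma>) (at 0)" and \<theta>0: "\<theta> 0 = 0"
    unfolding \<theta>_def by (auto intro!: derivative_eq_intros)
  have d: "((\<lambda>\<epsilon>. \<theta> \<epsilon> / \<epsilon>) \<longlongrightarrow> \<sigma>) (at 0)"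
    using D by (simp add: DERIV_def \<theta>0)
  have "(\<theta> \<longlongrightarrow> 0) (at 0)"
    using DERIV_isCont[OF D] by (simp add: isCont_def \<theta>0)
  then have c: "(\<theta> \<longlongrightarrow> 0) (at_right 0)"
    by (rule tendsto_within_subset) simp
  show d': "((\<lambda>\<epsilon>. \<theta> \<epsilon> / \<epsilon>) \<longlongrightarrow> \<sigma>) (at_right 0)"
    using d by (rule tendsto_within_subset) simp
  show f: "filterlim \<theta> (at 0) (at_right 0)"
    unfolding filterlim_at using c ne by simp
  have "(sinh has_real_derivative cosh 0) (at 0)"
    using has_field_derivative_sinh[OF DERIV_ident, of "0::real" UNIV] by simp
  then have "((\<lambda>t::real. sinh t / t) \<longlongrightarrow> 1) (at 0)"
    by (simp add: DERIV_def)
  then have "((\<lambda>t::real. inverse (sinh t / t)) \<longlongrightarrow> inverse 1) (at 0)"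
    by (rule tendsto_inverse) simp
  from filterlim_compose[OF this f]
  show s: "((\<lambda>\<epsilon>. \<theta> \<epsilon> / sinh (\<theta> \<epsilon>)) \<longlongrightarrow> 1) (at_right 0)"
    by simp
  have "((\<lambda>\<epsilon>. (\<theta> \<epsilon> / sinh (\<theta> \<epsilon>)) / (\<theta> \<epsilon> / \<epsilon>)) \<longlongrightarrow> 1 / \<sigma>) (at_right 0)"
    by (intro tendsto_intros s d' assms(1))
  moreover have "\<forall>\<^sub>F \<epsilon> in at_right 0. (\<theta> \<epsilon> / sinh (\<theta> \<epsilon>)) / (\<theta> \<epsilon> / \<epsilon>) = \<epsilon> / sinh (\<theta> \<epsilon>)"
    using ne eventually_at_right_less[of 0] by eventually_elim simp
  ultimately show "((\<lambda>\<epsilon>. \<epsilon> / sinh (\<theta> \<epsilon>)) \<longlongrightarrow> 1 / \<sigma>) (at_right 0)"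
    by (rule Lim_transform_eventually)
qed

section \<open>Limits of the scaled rates\<close>

text \<open>The two scaled rates have the same limit, so their difference needs the next order: both
  are compared with one reference expression at the same \<epsilon>. Positivity of
  \<open>lam + 2 * Eminus j x\<close> keeps the denominators away from 0.\<close>

lemma rate_limits:
  fixes \<sigma> lam :: real and k x :: "nat \<Rightarrow> real" and \<zeta> :: "real \<Rightarrow> nat \<Rightarrow> nat"
  assumes \<sigma>: "\<sigma> \<noteq> 0" and j: "j \<ge> 1" and pos: "lam + 2 * Eminus j x > 0"
    and \<zeta>: "\<And>i. ((\<lambda>\<epsilon>. \<epsilon> * real (\<zeta> \<epsilon> i)) \<longlongrightarrow> x i) (at_right 0)"
  defines "Cp \<equiv> \<lambda>\<epsilon>. rate_plus (1 - \<epsilon> * \<sigma>) k (lam / \<epsilon>) (\<zeta> \<epsilon>) j"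
    and "Cm \<equiv> \<lambda>\<epsilon>. rate_minus (1 - \<epsilon> * \<sigma>) k (lam / \<epsilon>) (\<zeta> \<epsilon>) (j+1)"
  shows "((\<lambda>\<epsilon>. \<epsilon>\<^sup>2 * Cp \<epsilon>) \<longlongrightarrow> abep_A \<sigma> lam x j) (at_right 0)"
    and "((\<lambda>\<epsilon>. \<epsilon>\<^sup>2 * Cm \<epsilon>) \<longlongrightarrow> abep_A \<sigma> lam x j) (at_right 0)"
    and "((\<lambda>\<epsilon>. \<epsilon> * (Cm \<epsilon> - Cp \<epsilon>)) \<longlongrightarrow> abep_B \<sigma> k lam x j) (at_right 0)"
proof -
  define \<theta> where "\<theta> = (\<lambda>\<epsilon>. - ln (1 - \<epsilon> * \<sigma>))"
  note lim = deformation_limits[OF \<sigma> \<theta>_def]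
  define a b H where "a = (\<lambda>\<epsilon>. \<theta> \<epsilon> * real (\<zeta> \<epsilon> j))" and "b = (\<lambda>\<epsilon>. \<theta> \<epsilon> * real (\<zeta> \<epsilon> (j+1)))"
    and "H = (\<lambda>\<epsilon>. \<theta> \<epsilon> * hminus k (lam / \<epsilon>) (\<zeta> \<epsilon>) j)"
  define a0 b0 H0 where "a0 = \<sigma> * x j" and "b0 = \<sigma> * x (j+1)" and "H0 = \<sigma> * (lam + 2 * Eminus j x)"
  have scaled: "((\<lambda>\<epsilon>. \<theta> \<epsilon> * real (\<zeta> \<epsilon> i)) \<longlongrightarrow> \<sigma> * x i) (at_right 0)" for i
  proof (rule Lim_transform_eventually)
    show "((\<lambda>\<epsilon>. \<theta> \<epsilon> / \<epsilon> * (\<epsilon> * real (\<zeta> \<epsilon> i))) \<longlongrightarrow> \<sigma> * x i) (at_right 0)"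
      by (intro tendsto_intros lim(3) \<zeta>)
    show "\<forall>\<^sub>F \<epsilon> in at_right 0. \<theta> \<epsilon> / \<epsilon> * (\<epsilon> * real (\<zeta> \<epsilon> i)) = \<theta> \<epsilon> * real (\<zeta> \<epsilon> i)"
      using eventually_at_right_less[of 0] by eventually_elim auto
  qed
  have a: "(a \<longlongrightarrow> a0) (at_right 0)" and b: "(b \<longlongrightarrow> b0) (at_right 0)"
    unfolding a_def b_def a0_def b0_def by (rule scaled)+
  have H: "(H \<longlongrightarrow> H0) (at_right 0)"
  proof (rule Lim_transform_eventually)
    \<comment> \<open>After multiplication by \<epsilon> the boundary value
      \<open>lam / \<epsilon>\<close> contributes \<open>lam\<close>, while the parameters
      \<open>k i\<close> vanish in the limit.\<close>
    have "((\<lambda>\<epsilon>. \<theta> \<epsilon> / \<epsilon> * (lam + (\<Sum>i=1..j. 2 * (\<epsilon> * real (\<zeta> \<epsilon> i)) + \<epsilon> * k i)))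
        \<longlongrightarrow> \<sigma> * (lam + (\<Sum>i=1..j. 2 * x i + 0 * k i))) (at_right 0)"
      by (intro tendsto_intros lim(3) \<zeta>)
    then show "((\<lambda>\<epsilon>. \<theta> \<epsilon> / \<epsilon> * (lam + (\<Sum>i=1..j. 2 * (\<epsilon> * real (\<zeta> \<epsilon> i)) + \<epsilon> * k i))) \<longlongrightarrow> H0) (at_right 0)"
      by (simp add: H0_def Eminus_def sum_distrib_left)
    show "\<forall>\<^sub>F \<epsilon> in at_right 0.
        \<theta> \<epsilon> / \<epsilon> * (lam + (\<Sum>i=1..j. 2 * (\<epsilon> * real (\<zeta> \<epsilon> i)) + \<epsilon> * k i)) = H \<epsilon>"
      using eventually_at_right_less[of 0]
    proof eventually_elim
      case (elim \<epsilon>)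
      have "lam + (\<Sum>i=1..j. 2 * (\<epsilon> * real (\<zeta> \<epsilon> i)) + \<epsilon> * k i) = \<epsilon> * hminus k (lam / \<epsilon>) (\<zeta> \<epsilon>) j"
        using elim by (simp add: hminus_def distrib_left sum_distrib_left mult.left_commute)
      then show ?case using elim by (simp add: H_def)
    qed
  qed
  have H0: "sinh H0 \<noteq> 0"
    using \<sigma> pos by (simp add: H0_def)
  have Ha: "((\<lambda>\<epsilon>. H \<epsilon> - a \<epsilon>) \<longlongrightarrow> H0 - a0) (at_right 0)"
    and Hb: "((\<lambda>\<epsilon>. H \<epsilon> + b \<epsilon>) \<longlongrightarrow> H0 + b0) (at_right 0)"
    by (intro tendsto_intros a b H)+
  note const = tendsto_sinh[THEN first_order_const, of _ _ _ \<theta>]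
  note perturbed = first_order_sinh[OF _ lim(2)]
  \<comment> \<open>\<open>S\<close> is the common leading term of \<open>P\<close> and
    \<open>N\<close>. A further factor \<open>inverse (sinh (H \<epsilon>))\<close>, which neither
    rate perturbs, is kept apart and multiplied in later.\<close>
  define S where "S = (\<lambda>\<epsilon>. sinh (a \<epsilon>) * sinh (b \<epsilon>) * sinh (H \<epsilon> - a \<epsilon>) * sinh (H \<epsilon> + b \<epsilon>) * inverse (sinh (H \<epsilon>)))"
  define P where "P = (\<lambda>\<epsilon>. sinh (a \<epsilon>) * sinh (b \<epsilon> + k (j+1) * \<theta> \<epsilon>) * sinh (H \<epsilon> - a \<epsilon> + (- k j) * \<theta> \<epsilon>)
      * sinh (H \<epsilon> + b \<epsilon>) * inverse (sinh (H \<epsilon> + (- 1) * \<theta> \<epsilon>)))"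
  define N where "N = (\<lambda>\<epsilon>. sinh (a \<epsilon> + k j * \<theta> \<epsilon>) * sinh (b \<epsilon>) * sinh (H \<epsilon> - a \<epsilon>)
      * sinh (H \<epsilon> + b \<epsilon> + k (j+1) * \<theta> \<epsilon>) * inverse (sinh (H \<epsilon> + 1 * \<theta> \<epsilon>)))"
  have ev: "\<forall>\<^sub>F \<epsilon> in at_right 0.
      Cp \<epsilon> = P \<epsilon> * inverse (sinh (H \<epsilon>)) / (sinh (\<theta> \<epsilon>))\<^sup>2 \<and> Cm \<epsilon> = N \<epsilon> * inverse (sinh (H \<epsilon>)) / (sinh (\<theta> \<epsilon>))\<^sup>2
      \<and> \<theta> \<epsilon> \<noteq> 0"
    using lim(1)
  proof eventually_elim
    case (elim \<epsilon>)
    then show ?case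
      unfolding Cp_def Cm_def P_def N_def
      by (subst rate_plus_eq[OF _ _ j \<theta>_def[THEN fun_cong] a_def[THEN fun_cong] b_def[THEN fun_cong] H_def[THEN fun_cong]], simp, simp,
          subst rate_minus_eq[OF _ _ \<theta>_def[THEN fun_cong] a_def[THEN fun_cong] b_def[THEN fun_cong] H_def[THEN fun_cong]])
        (auto simp: \<theta>_def)
  qed
  \<comment> \<open>One summand for each perturbed factor, with coefficients \<open>k (j+1)\<close>,
    \<open>- k j\<close> and \<open>- 1\<close>; for \<open>N\<close> they are \<open>k j\<close>,
    \<open>k (j+1)\<close> and \<open>1\<close>. The nesting of \<open>first_order_mult\<close>
    follows the left association of the products.\<close>
  have Pfo: "first_order (at_right 0) \<theta> S P
      (sinh a0 * sinh b0 * sinh (H0 - a0) * sinh (H0 + b0) * inverse (sinh H0))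
      (sinh a0 * (k (j+1) * cosh b0) * sinh (H0 - a0) * sinh (H0 + b0) / sinh H0
       - sinh a0 * sinh b0 * (k j * cosh (H0 - a0)) * sinh (H0 + b0) / sinh H0
       + sinh a0 * sinh b0 * sinh (H0 - a0) * sinh (H0 + b0) * cosh H0 / (sinh H0)\<^sup>2)" (is "first_order _ _ _ _ ?s ?p")
    unfolding S_def P_def
    by (rule first_order_eqI[OF first_order_mult[OF first_order_mult[OF first_order_mult[OF
        first_order_mult[OF const[OF a] perturbed[OF b]] perturbed[OF Ha]] const[OF Hb]]
        first_order_inverse[OF perturbed[OF H] H0]]]) (simp add: divide_inverse algebra_simps)
  have Nfo: "first_order (at_right 0) \<theta> S N
      (sinh a0 * sinh b0 * sinh (H0 - a0) * sinh (H0 + b0) * inverse (sinh H0))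
      (sinh b0 * (k j * cosh a0) * sinh (H0 - a0) * sinh (H0 + b0) / sinh H0
       + sinh a0 * sinh b0 * sinh (H0 - a0) * (k (j+1) * cosh (H0 + b0)) / sinh H0
       - sinh a0 * sinh b0 * sinh (H0 - a0) * sinh (H0 + b0) * cosh H0 / (sinh H0)\<^sup>2)" (is "first_order _ _ _ _ _ ?n")
    unfolding S_def N_def
    by (rule first_order_eqI[OF first_order_mult[OF first_order_mult[OF first_order_mult[OF
        first_order_mult[OF perturbed[OF a] const[OF b]] const[OF Ha]] perturbed[OF Hb]]
        first_order_inverse[OF perturbed[OF H] H0]]]) (simp add: divide_inverse algebra_simps)
  have invH: "((\<lambda>\<epsilon>. inverse (sinh (H \<epsilon>))) \<longlongrightarrow> inverse (sinh H0)) (at_right 0)"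
    by (intro tendsto_intros H H0)
  have A: "?s * inverse (sinh H0) * (1 / \<sigma>)\<^sup>2 = abep_A \<sigma> lam x j"
    unfolding abep_A_def sinhs_def a0_def b0_def H0_def
    by (simp add: divide_inverse power2_eq_square algebra_simps)
  \<comment> \<open>Every first-order perturbation of \<open>S\<close> tends to \<open>?s\<close>,
    so one computation serves both rates.\<close>
  have *: "((\<lambda>\<epsilon>. X \<epsilon> * inverse (sinh (H \<epsilon>)) * (\<epsilon> / sinh (\<theta> \<epsilon>))\<^sup>2) \<longlongrightarrow> abep_A \<sigma> lam x j) (at_right 0)"
    if "first_order (at_right 0) \<theta> S X ?s d" for X d
    unfolding A[symmetric] using that by (intro tendsto_intros invH lim(4)) (auto simp: first_order_def)
  show "((\<lambda>\<epsilon>. \<epsilon>\<^sup>2 * Cp \<epsilon>) \<longlongrightarrow> abep_A \<sigma> lam x j) (at_right 0)"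
    by (rule Lim_transform_eventually[OF *[OF Pfo]])
      (use ev in \<open>auto elim!: eventually_mono simp: power_divide\<close>)
  show "((\<lambda>\<epsilon>. \<epsilon>\<^sup>2 * Cm \<epsilon>) \<longlongrightarrow> abep_A \<sigma> lam x j) (at_right 0)"
    by (rule Lim_transform_eventually[OF *[OF Nfo]])
      (use ev in \<open>auto elim!: eventually_mono simp: power_divide\<close>)
  \<comment> \<open>Writing \<open>H0\<close> as \<open>a0 + (H0 - a0)\<close> and as
    \<open>(H0 + b0) - b0\<close> collapses the terms with \<open>k j\<close> and
    \<open>k (j+1)\<close> in \<open>?n - ?p\<close> to a factor \<open>sinh H0\<close>, which
    cancels one denominator.\<close>
  have sH: "cosh a0 * sinh (H0 - a0) + sinh a0 * cosh (H0 - a0) = sinh H0"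
    "cosh b0 * sinh (H0 + b0) - sinh b0 * cosh (H0 + b0) = sinh H0"
    using sinh_add[of a0 "H0 - a0"] sinh_diff[of "H0 + b0" b0] by (simp_all add: ac_simps)
  have "?n - ?p = k j * sinh b0 * sinh (H0 + b0) / sinh H0 * (cosh a0 * sinh (H0 - a0) + sinh a0 * cosh (H0 - a0))
     - k (j+1) * sinh a0 * sinh (H0 - a0) / sinh H0 * (cosh b0 * sinh (H0 + b0) - sinh b0 * cosh (H0 + b0))
     - 2 * sinh a0 * sinh b0 * sinh (H0 - a0) * sinh (H0 + b0) * cosh H0 / (sinh H0)\<^sup>2"
    by (simp add: divide_inverse algebra_simps)
  also have "\<dots> = k j * sinh b0 * sinh (H0 + b0) - k (j+1) * sinh a0 * sinh (H0 - a0)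
     - 2 * sinh a0 * sinh b0 * sinh (H0 - a0) * sinh (H0 + b0) * cosh H0 / (sinh H0)\<^sup>2"
    unfolding sH using H0 by simp
  finally have np0: "?n - ?p = \<dots>" .
  have np: "(?n - ?p) * inverse (sinh H0) * 1 * (1 / \<sigma>) = abep_B \<sigma> k lam x j"
    unfolding np0 unfolding abep_B_def sinhs_def coshs_def a0_def b0_def H0_def
    by (simp add: divide_inverse power2_eq_square power3_eq_cube algebra_simps)
  \<comment> \<open>\<open>S\<close> cancels in the difference, which is of order \<theta>. Of the
    two factors \<open>1 / sinh \<theta>\<close>, one is paired with \<theta> (limit 1) and one with
    \<epsilon> (limit \<open>1 / \<sigma>\<close>).\<close>
  show "((\<lambda>\<epsilon>. \<epsilon> * (Cm \<epsilon> - Cp \<epsilon>)) \<longlongrightarrow> abep_B \<sigma> k lam x j) (at_right 0)"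
  proof (rule Lim_transform_eventually)
    show "((\<lambda>\<epsilon>. ((N \<epsilon> - S \<epsilon>) / \<theta> \<epsilon> - (P \<epsilon> - S \<epsilon>) / \<theta> \<epsilon>) * inverse (sinh (H \<epsilon>))
        * (\<theta> \<epsilon> / sinh (\<theta> \<epsilon>)) * (\<epsilon> / sinh (\<theta> \<epsilon>))) \<longlongrightarrow> abep_B \<sigma> k lam x j) (at_right 0)"
      unfolding np[symmetric] using Nfo Pfo
      by (intro tendsto_intros invH lim) (auto simp: first_order_def)
    show "\<forall>\<^sub>F \<epsilon> in at_right 0. ((N \<epsilon> - S \<epsilon>) / \<theta> \<epsilon> - (P \<epsilon> - S \<epsilon>) / \<theta> \<epsilon>) * inverse (sinh (H \<epsilon>))
        * (\<theta> \<epsilon> / sinh (\<theta> \<epsilon>)) * (\<epsilon> / sinh (\<theta> \<epsilon>)) = \<epsilon> * (Cm \<epsilon> - Cp \<epsilon>)"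
      using ev
    proof eventually_elim
      case (elim \<epsilon>)
      have "((N \<epsilon> - S \<epsilon>) / \<theta> \<epsilon> - (P \<epsilon> - S \<epsilon>) / \<theta> \<epsilon>) * inverse (sinh (H \<epsilon>))
          * (\<theta> \<epsilon> / sinh (\<theta> \<epsilon>)) * (\<epsilon> / sinh (\<theta> \<epsilon>))
        = (\<theta> \<epsilon> * inverse (\<theta> \<epsilon>)) * ((N \<epsilon> - P \<epsilon>) * inverse (sinh (H \<epsilon>)) * \<epsilon> / (sinh (\<theta> \<epsilon>))\<^sup>2)"
        by (simp add: divide_inverse power2_eq_square algebra_simps)
      also have "\<theta> \<epsilon> * inverse (\<theta> \<epsilon>) = 1"
        using elim by simp
      finally show ?case
        using elim by (simp add: divide_inverse algebra_simps)
    qed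
  qed
qed

section \<open>Convergence of the generators\<close>

lemma scaled_floor_error:
  assumes "x \<in> Xc M" "\<epsilon> > 0"
  shows "\<bar>\<epsilon> * real (floor_vec (\<lambda>i. x i / \<epsilon>) i) - x i\<bar> \<le> \<epsilon>"
proof -
  let ?n = "\<lfloor>x i / \<epsilon>\<rfloor>"
  have "0 \<le> ?n" using Xc_nonneg[OF assms(1), of i] assms(2) by simp
  then have eq: "real (floor_vec (\<lambda>i. x i / \<epsilon>) i) = of_int ?n"
    by (simp add: floor_vec_def)
  have "of_int ?n \<le> x i / \<epsilon>" "x i / \<epsilon> < of_int ?n + 1" by linarith+
  then have "\<epsilon> * of_int ?n \<le> x i" "x i < \<epsilon> * of_int ?n + \<epsilon>"
    using assms(2) by (simp_all add: field_simps del: of_int_floor_le)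
  then show ?thesis unfolding eq by linarith
qed

lemma scaled_floor_box:
  assumes "x \<in> Xc M" "\<epsilon> > 0"
  shows "(\<lambda>i. \<epsilon> * real (floor_vec (\<lambda>i. x i / \<epsilon>) i)) \<in> orthant_box M \<epsilon> x"
proof -
  have "(\<lambda>i. \<epsilon> * real (floor_vec (\<lambda>i. x i / \<epsilon>) i)) \<in> Xc M"
    using assms by (auto simp: Xc_def floor_vec_def)
  then show ?thesis using scaled_floor_error[OF assms] by (simp add: orthant_box_def)
qed

lemma rescale_incl: "\<epsilon> \<noteq> 0 \<Longrightarrow> rescale \<epsilon> g (\<lambda>i. \<epsilon> * real (\<zeta> i)) = (g \<circ> incl) \<zeta>"
  by (simp add: rescale_def incl_def)

text \<open>Lattice jumps are steps of length \<epsilon> along the path. The departing site must be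
  occupied, for otherwise \<open>move\<close> is the identity while \<open>shift\<close> is
  not.\<close>

lemma rescale_shift:
  assumes "\<epsilon> \<noteq> 0"
  shows "\<zeta> j \<ge> 1 \<Longrightarrow> rescale \<epsilon> g (shift j (- \<epsilon>) (\<lambda>i. \<epsilon> * real (\<zeta> i))) = (g \<circ> incl) (move \<zeta> j (j + 1))"
    and "\<zeta> (j + 1) \<ge> 1 \<Longrightarrow> rescale \<epsilon> g (shift j \<epsilon> (\<lambda>i. \<epsilon> * real (\<zeta> i))) = (g \<circ> incl) (move \<zeta> (j + 1) j)"
proof -
  show "rescale \<epsilon> g (shift j (- \<epsilon>) (\<lambda>i. \<epsilon> * real (\<zeta> i))) = (g \<circ> incl) (move \<zeta> j (j + 1))" if "\<zeta> j \<ge> 1"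
  proof -
    have "(\<lambda>i. shift j (- \<epsilon>) (\<lambda>i. \<epsilon> * real (\<zeta> i)) i / \<epsilon>) = incl (move \<zeta> j (j + 1))"
      using that assms by (auto simp: fun_eq_iff shift_def incl_def move_def field_simps of_nat_diff)
    then show ?thesis by (simp add: rescale_def)
  qed
  show "rescale \<epsilon> g (shift j \<epsilon> (\<lambda>i. \<epsilon> * real (\<zeta> i))) = (g \<circ> incl) (move \<zeta> (j + 1) j)" if "\<zeta> (j + 1) \<ge> 1"
  proof -
    have "(\<lambda>i. shift j \<epsilon> (\<lambda>i. \<epsilon> * real (\<zeta> i)) i / \<epsilon>) = incl (move \<zeta> (j + 1) j)"
      using that assms by (auto simp: fun_eq_iff shift_def incl_def move_def field_simps of_nat_diff)
    then show ?thesis by (simp add: rescale_def)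
  qed
qed

text \<open>\<open>y\<close> is within \<epsilon> of \<open>x\<close> in each coordinate and the
  path adds at most another \<epsilon>; hence \<open>2 * \<epsilon> \<le> r\<close> keeps it where
  \<open>K\<close> applies.\<close>

lemma shift_Taylor_box:
  assumes g: "Ck M (Suc (Suc (Suc n))) g" and y: "y \<in> orthant_box M \<epsilon> x" and j: "j \<in> {1..<M}"
    and t: "t \<in> {- y j..y (j + 1)}" "\<bar>t\<bar> = \<epsilon>" and r: "2 * \<epsilon> \<le> r"
    and K: "\<And>z. z \<in> orthant_box M r x \<Longrightarrow> \<bar>pdiff j (pdiff j (pdiff j g)) z\<bar> \<le> K"
  shows "\<bar>g (shift j t y) - g y - t * pdiff j g y - t\<^sup>2 / 2 * pdiff j (pdiff j g) y\<bar> \<le> K * \<epsilon> ^ 3"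
proof -
  have yX: "y \<in> Xc M" using y by (simp add: orthant_box_def)
  have "\<bar>pdiff j (pdiff j (pdiff j g)) (shift j s y)\<bar> \<le> K" if s: "s \<in> closed_segment 0 t" for s
  proof (rule K)
    have st: "\<bar>s\<bar> \<le> \<epsilon>" "s \<in> {- y j..y (j + 1)}"
      using s t Xc_nonneg[OF yX, of j] Xc_nonneg[OF yX, of "j + 1"]
      by (auto simp: closed_segment_eq_real_ivl split: if_splits)
    have "\<bar>shift j s y i - x i\<bar> \<le> r" if i: "i \<in> {1..M}" for i
    proof -
      have "\<bar>y i - x i\<bar> \<le> \<epsilon>" using y i by (simp add: orthant_box_def)
      then show ?thesis using st(1) r by (auto simp: shift_def)
    qed
    then show "shift j s y \<in> orthant_box M r x"
      using shift_Xc[OF yX j st(2)] by (simp add: orthant_box_def)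
  qed
  from shift_Taylor[OF g yX j t(1) this] show ?thesis unfolding t(2) .
qed

section \<open>The contribution of one bond\<close>

text \<open>Taylor remainders of order \<open>\<epsilon> ^ 3\<close> meet rates of order
  \<open>1 / \<epsilon>\<^sup>2\<close>. First derivatives must converge at all points, since
  bounding their gradient takes a second point; for second derivatives \<open>x\<close> suffices, as
  third derivatives bound their gradient.\<close>

lemma site_generator_limit:
  fixes \<sigma> lam \<epsilon>' :: real and k x :: "nat \<Rightarrow> real"
  assumes \<sigma>: "\<sigma> \<noteq> 0" and lam: "lam > 0" and \<epsilon>': "\<epsilon>' > 0"
    and F: "\<And>\<epsilon>. 0 < \<epsilon> \<Longrightarrow> \<epsilon> < \<epsilon>' \<Longrightarrow> Ck M 3 (F \<epsilon>)"
    and x: "x \<in> Xc M" and j: "j \<in> {1..<M}"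
    and bound: "\<forall>a\<in>{1..M}. \<forall>b\<in>{1..M}. \<forall>c\<in>{1..M}. \<exists>K. \<forall>\<epsilon>. 0 < \<epsilon> \<and> \<epsilon> < \<epsilon>' \<longrightarrow>
           (\<forall>y\<in>nbhd M \<epsilon>' x. \<bar>partial a (partial b (partial c (rescale \<epsilon> (F \<epsilon>)))) y\<bar> \<le> K)"
    and lim1: "\<And>z. z \<in> Xc M \<Longrightarrow> ((\<lambda>\<epsilon>. pdiff j (rescale \<epsilon> (F \<epsilon>)) z) \<longlongrightarrow> pdiff j f z) (at_right 0)"
    and lim2: "((\<lambda>\<epsilon>. pdiff j (pdiff j (rescale \<epsilon> (F \<epsilon>))) x) \<longlongrightarrow> pdiff j (pdiff j f) x) (at_right 0)"
  defines "\<zeta> \<equiv> \<lambda>\<epsilon>. floor_vec (\<lambda>i. x i / \<epsilon>)"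
  shows "((\<lambda>\<epsilon>. rate_plus (1 - \<epsilon> * \<sigma>) k (lam / \<epsilon>) (\<zeta> \<epsilon>) j
                * ((F \<epsilon> \<circ> incl) (move (\<zeta> \<epsilon>) j (j + 1)) - (F \<epsilon> \<circ> incl) (\<zeta> \<epsilon>))
              + rate_minus (1 - \<epsilon> * \<sigma>) k (lam / \<epsilon>) (\<zeta> \<epsilon>) (j + 1)
                * ((F \<epsilon> \<circ> incl) (move (\<zeta> \<epsilon>) (j + 1) j) - (F \<epsilon> \<circ> incl) (\<zeta> \<epsilon>)))
          \<longlongrightarrow> abep_A \<sigma> lam x j * pdiff j (pdiff j f) x + abep_B \<sigma> k lam x j * pdiff j f x) (at_right 0)"
proof -
  define G where "G = (\<lambda>\<epsilon>. rescale \<epsilon> (F \<epsilon>))"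
  \<comment> \<open>By \<open>box_subset_nbhd\<close> the box of this radius lies in the
    neighbourhood where third derivatives are bounded.\<close>
  define r where "r = \<epsilon>' / (real M + 1)"
  define y where "y = (\<lambda>\<epsilon> i. \<epsilon> * real (\<zeta> \<epsilon> i))"
  have r: "r > 0" using \<epsilon>' by (simp add: r_def)
  have small: "\<forall>\<^sub>F \<epsilon> in at_right 0. 0 < \<epsilon> \<and> \<epsilon> < \<epsilon>' \<and> 2 * \<epsilon> \<le> r"
    unfolding eventually_at_right_field using \<epsilon>' r by (intro exI[of _ "min \<epsilon>' (r / 2)"]) auto
  have G3: "Ck M (Suc (Suc (Suc 0))) (G \<epsilon>)" if "0 < \<epsilon>" "\<epsilon> < \<epsilon>'" for \<epsilon>
    using Ck_rescale[OF F[OF that] that(1)] by (simp only: G_def numeral_3_eq_3)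
  have "\<exists>K. \<forall>p\<in>{1..M} \<times> {1..M} \<times> {1..M}. \<forall>\<epsilon>. 0 < \<epsilon> \<and> \<epsilon> < \<epsilon>' \<longrightarrow>
      (\<forall>z\<in>nbhd M \<epsilon>' x. \<bar>partial (fst p) (partial (fst (snd p)) (partial (snd (snd p)) (G \<epsilon>))) z\<bar> \<le> K)"
    by (rule finite_common_bound) (use bound in \<open>auto simp: G_def intro: order_trans\<close>)
  then obtain K where K0: "\<forall>p\<in>{1..M} \<times> {1..M} \<times> {1..M}. \<forall>\<epsilon>. 0 < \<epsilon> \<and> \<epsilon> < \<epsilon>' \<longrightarrow>
      (\<forall>z\<in>nbhd M \<epsilon>' x. \<bar>partial (fst p) (partial (fst (snd p)) (partial (snd (snd p)) (G \<epsilon>))) z\<bar> \<le> K)" ..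
  have K: "\<bar>partial a (partial b (partial c (G \<epsilon>))) z\<bar> \<le> K"
    if "0 < \<epsilon>" "\<epsilon> < \<epsilon>'" "z \<in> orthant_box M r x" "a \<in> {1..M}" "b \<in> {1..M}" "c \<in> {1..M}" for \<epsilon> z a b c
    using K0[rule_format, of "(a, b, c)" \<epsilon> z] that box_subset_nbhd[OF \<epsilon>', of M x] by (auto simp: r_def)
  have boxX: "z \<in> Xc M" if "z \<in> orthant_box M r x" for z using that by (simp add: orthant_box_def)
  have lim1': "((\<lambda>\<epsilon>. pdiff j (G \<epsilon>) z) \<longlongrightarrow> pdiff j f z) (at_right 0)" if "z \<in> Xc M" for z
    unfolding G_def by (rule lim1[OF that])
  note bounds = third_directional_bounds[OF G3 j boxX K]
  have u: "\<forall>\<^sub>F \<epsilon> in at_right 0. Ck M (Suc (Suc 0)) (pdiff j (G \<epsilon>)) \<and>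
      (\<forall>a\<in>{1..M}. \<forall>b\<in>{1..M}. \<forall>z\<in>orthant_box M r x. \<bar>partial a (partial b (pdiff j (G \<epsilon>))) z\<bar> \<le> 2 * K)"
    using small
  proof eventually_elim
    case (elim \<epsilon>)
    then have e: "0 < \<epsilon>" "\<epsilon> < \<epsilon>'" by auto
    show ?case using Ck_pdiff[OF G3[OF e] j] bounds(1)[OF e _ e] by blast
  qed
  have w: "\<forall>\<^sub>F \<epsilon> in at_right 0. Ck M (Suc 0) (pdiff j (pdiff j (G \<epsilon>))) \<and>
      (\<forall>a\<in>{1..M}. \<forall>z\<in>orthant_box M r x. \<bar>partial a (pdiff j (pdiff j (G \<epsilon>))) z\<bar> \<le> 4 * K)"
    using small
  proof eventually_elim
    case (elim \<epsilon>)
    then have e: "0 < \<epsilon>" "\<epsilon> < \<epsilon>'" by auto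
    show ?case using Ck_pdiff[OF Ck_pdiff[OF G3[OF e] j] j] bounds(2)[OF e _ e] by blast
  qed
  obtain K' where "\<forall>\<^sub>F \<epsilon> in at_right 0. \<forall>i\<in>{1..M}. \<forall>z\<in>orthant_box M r x. \<bar>partial i (pdiff j (G \<epsilon>)) z\<bar> \<le> K'"
    using gradient_eventually_bounded[OF x r u lim1'] by blast
  with u have u': "\<forall>\<^sub>F \<epsilon> in at_right 0. Ck M (Suc (Suc 0)) (pdiff j (G \<epsilon>)) \<and>
      (\<forall>i\<in>{1..M}. \<forall>z\<in>orthant_box M r x. \<bar>partial i (pdiff j (G \<epsilon>)) z\<bar> \<le> K')"
    by eventually_elim blast
  have ybox: "y \<epsilon> \<in> orthant_box M \<epsilon> x" if "\<epsilon> > 0" for \<epsilon>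
    unfolding y_def \<zeta>_def by (rule scaled_floor_box[OF x that])
  have Y: "\<forall>\<^sub>F \<epsilon> in at_right 0. y \<epsilon> \<in> orthant_box M \<epsilon> x"
    using small by eventually_elim (use ybox in blast)
  have Du: "((\<lambda>\<epsilon>. pdiff j (G \<epsilon>) (y \<epsilon>)) \<longlongrightarrow> pdiff j f x) (at_right 0)"
    by (rule tendsto_moving_point[OF x r u' Y]) (rule lim1'[OF x])
  have Dw: "((\<lambda>\<epsilon>. pdiff j (pdiff j (G \<epsilon>)) (y \<epsilon>)) \<longlongrightarrow> pdiff j (pdiff j f) x) (at_right 0)"
    by (rule tendsto_moving_point[OF x r w Y]) (use lim2 in \<open>simp add: G_def\<close>)
  define Cp Cm where "Cp = (\<lambda>\<epsilon>. rate_plus (1 - \<epsilon> * \<sigma>) k (lam / \<epsilon>) (\<zeta> \<epsilon>) j)"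
    and "Cm = (\<lambda>\<epsilon>. rate_minus (1 - \<epsilon> * \<sigma>) k (lam / \<epsilon>) (\<zeta> \<epsilon>) (j + 1))"
  have \<epsilon>0: "((\<lambda>\<epsilon>. \<epsilon>) \<longlongrightarrow> (0::real)) (at_right 0)" by (rule tendsto_ident_at)
  have "((\<lambda>\<epsilon>. \<epsilon> * real (\<zeta> \<epsilon> i)) \<longlongrightarrow> x i) (at_right 0)" for i
  proof (rule LIM_zero_cancel, rule Lim_null_comparison[OF _ \<epsilon>0])
    show "\<forall>\<^sub>F \<epsilon> in at_right 0. norm (\<epsilon> * real (\<zeta> \<epsilon> i) - x i) \<le> \<epsilon>"
      using small by eventually_elim (use scaled_floor_error[OF x] in \<open>simp add: \<zeta>_def\<close>)
  qed
  moreover have "lam + 2 * Eminus j x > 0"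
    unfolding Eminus_def using lam Xc_nonneg[OF x] by (intro add_pos_nonneg) (auto intro: sum_nonneg)
  ultimately have rates: "((\<lambda>\<epsilon>. \<epsilon>\<^sup>2 * Cp \<epsilon>) \<longlongrightarrow> abep_A \<sigma> lam x j) (at_right 0)"
    "((\<lambda>\<epsilon>. \<epsilon>\<^sup>2 * Cm \<epsilon>) \<longlongrightarrow> abep_A \<sigma> lam x j) (at_right 0)"
    "((\<lambda>\<epsilon>. \<epsilon> * (Cm \<epsilon> - Cp \<epsilon>)) \<longlongrightarrow> abep_B \<sigma> k lam x j) (at_right 0)"
    unfolding Cp_def Cm_def using rate_limits[OF \<sigma>, of j lam x \<zeta> k] j by auto
  \<comment> \<open>\<open>?T\<close> is the exact contribution and \<open>?S\<close> its version
    with second-order Taylor polynomials: the second derivative carries the mean of the rates, the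
    first derivative their difference.\<close>
  let ?T = "\<lambda>\<epsilon>. Cp \<epsilon> * ((F \<epsilon> \<circ> incl) (move (\<zeta> \<epsilon>) j (j + 1)) - (F \<epsilon> \<circ> incl) (\<zeta> \<epsilon>))
      + Cm \<epsilon> * ((F \<epsilon> \<circ> incl) (move (\<zeta> \<epsilon>) (j + 1) j) - (F \<epsilon> \<circ> incl) (\<zeta> \<epsilon>))"
  let ?S = "\<lambda>\<epsilon>. (\<epsilon>\<^sup>2 * Cp \<epsilon> + \<epsilon>\<^sup>2 * Cm \<epsilon>) / 2 * pdiff j (pdiff j (G \<epsilon>)) (y \<epsilon>)
      + \<epsilon> * (Cm \<epsilon> - Cp \<epsilon>) * pdiff j (G \<epsilon>) (y \<epsilon>)"
  have S: "(?S \<longlongrightarrow> (abep_A \<sigma> lam x j + abep_A \<sigma> lam x j) / 2 * pdiff j (pdiff j f) x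
      + abep_B \<sigma> k lam x j * pdiff j f x) (at_right 0)"
    by (intro tendsto_intros rates Du Dw) simp
  have "((\<lambda>\<epsilon>. ?T \<epsilon> - ?S \<epsilon>) \<longlongrightarrow> 0) (at_right 0)"
  proof (rule Lim_null_comparison)
    have "((\<lambda>\<epsilon>. (\<bar>\<epsilon>\<^sup>2 * Cp \<epsilon>\<bar> + \<bar>\<epsilon>\<^sup>2 * Cm \<epsilon>\<bar>) * (8 * K) * \<epsilon>) \<longlongrightarrow>
        (\<bar>abep_A \<sigma> lam x j\<bar> + \<bar>abep_A \<sigma> lam x j\<bar>) * (8 * K) * 0) (at_right 0)"
      by (intro tendsto_intros rates \<epsilon>0)
    then show "((\<lambda>\<epsilon>. (\<bar>\<epsilon>\<^sup>2 * Cp \<epsilon>\<bar> + \<bar>\<epsilon>\<^sup>2 * Cm \<epsilon>\<bar>) * (8 * K) * \<epsilon>) \<longlongrightarrow> 0) (at_right 0)" by simp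
    show "\<forall>\<^sub>F \<epsilon> in at_right 0. norm (?T \<epsilon> - ?S \<epsilon>) \<le> (\<bar>\<epsilon>\<^sup>2 * Cp \<epsilon>\<bar> + \<bar>\<epsilon>\<^sup>2 * Cm \<epsilon>\<bar>) * (8 * K) * \<epsilon>"
      using small
    proof eventually_elim
      case (elim \<epsilon>)
      then have e: "0 < \<epsilon>" "\<epsilon> < \<epsilon>'" and re: "2 * \<epsilon> \<le> r" by auto
      define D D2 where "D = pdiff j (G \<epsilon>) (y \<epsilon>)" and "D2 = pdiff j (pdiff j (G \<epsilon>)) (y \<epsilon>)"
      have Taylor: "\<bar>G \<epsilon> (shift j t (y \<epsilon>)) - G \<epsilon> (y \<epsilon>) - t * D - t\<^sup>2 / 2 * D2\<bar> \<le> 8 * K * \<epsilon> ^ 3"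
        if "t \<in> {- y \<epsilon> j..y \<epsilon> (j + 1)}" "\<bar>t\<bar> = \<epsilon>" for t
        unfolding D_def D2_def
        by (rule shift_Taylor_box[OF G3[OF e] ybox[OF e(1)] j that re bounds(3)[OF e _ e]])
      have y0: "y \<epsilon> i \<ge> 0" for i using e by (simp add: y_def)
      have Gy: "(F \<epsilon> \<circ> incl) (\<zeta> \<epsilon>) = G \<epsilon> (y \<epsilon>)"
        unfolding G_def y_def using e by (intro rescale_incl[symmetric]) simp
      let ?p = "(F \<epsilon> \<circ> incl) (move (\<zeta> \<epsilon>) j (j + 1)) - (F \<epsilon> \<circ> incl) (\<zeta> \<epsilon>) - (- \<epsilon> * D + \<epsilon>\<^sup>2 / 2 * D2)"
      let ?m = "(F \<epsilon> \<circ> incl) (move (\<zeta> \<epsilon>) (j + 1) j) - (F \<epsilon> \<circ> incl) (\<zeta> \<epsilon>) - (\<epsilon> * D + \<epsilon>\<^sup>2 / 2 * D2)"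
      have p: "\<bar>Cp \<epsilon> * ?p\<bar> \<le> \<bar>Cp \<epsilon>\<bar> * (8 * K * \<epsilon> ^ 3)"
      proof (cases "\<zeta> \<epsilon> j = 0")
        case True
        then show ?thesis by (simp add: Cp_def rate_plus_def)
      next
        case False
        then have "\<epsilon> * 1 \<le> y \<epsilon> j"
          unfolding y_def using e by (intro mult_left_mono) auto
        then have mem: "- \<epsilon> \<in> {- y \<epsilon> j..y \<epsilon> (j + 1)}"
          using e y0[of "j + 1"] by simp
        have "G \<epsilon> (shift j (- \<epsilon>) (y \<epsilon>)) = (F \<epsilon> \<circ> incl) (move (\<zeta> \<epsilon>) j (j + 1))"
          unfolding G_def y_def using e False by (intro rescale_shift(1)) auto
        with Taylor[OF mem] have "\<bar>?p\<bar> \<le> 8 * K * \<epsilon> ^ 3"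
          unfolding Gy using e by (simp add: algebra_simps)
        then show ?thesis unfolding abs_mult by (rule mult_left_mono) simp
      qed
      have m: "\<bar>Cm \<epsilon> * ?m\<bar> \<le> \<bar>Cm \<epsilon>\<bar> * (8 * K * \<epsilon> ^ 3)"
      proof (cases "\<zeta> \<epsilon> (j + 1) = 0")
        case True
        then show ?thesis by (simp add: Cm_def rate_minus_def)
      next
        case False
        then have "\<epsilon> * 1 \<le> y \<epsilon> (j + 1)"
          unfolding y_def using e by (intro mult_left_mono) auto
        then have mem: "\<epsilon> \<in> {- y \<epsilon> j..y \<epsilon> (j + 1)}"
          using e y0[of "j"] by simp
        have "G \<epsilon> (shift j \<epsilon> (y \<epsilon>)) = (F \<epsilon> \<circ> incl) (move (\<zeta> \<epsilon>) (j + 1) j)"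
          unfolding G_def y_def using e False by (intro rescale_shift(2)) auto
        with Taylor[OF mem] have "\<bar>?m\<bar> \<le> 8 * K * \<epsilon> ^ 3"
          unfolding Gy using e by (simp add: algebra_simps)
        then show ?thesis unfolding abs_mult by (rule mult_left_mono) simp
      qed
      have "?T \<epsilon> - ?S \<epsilon> = Cp \<epsilon> * ?p + Cm \<epsilon> * ?m"
        by (simp add: D_def D2_def field_simps)
      then have "norm (?T \<epsilon> - ?S \<epsilon>) \<le> \<bar>Cp \<epsilon>\<bar> * (8 * K * \<epsilon> ^ 3) + \<bar>Cm \<epsilon>\<bar> * (8 * K * \<epsilon> ^ 3)"
        using p m unfolding real_norm_def by linarith
      also have "\<dots> = (\<bar>\<epsilon>\<^sup>2 * Cp \<epsilon>\<bar> + \<bar>\<epsilon>\<^sup>2 * Cm \<epsilon>\<bar>) * (8 * K) * \<epsilon>"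
        by (simp add: abs_mult power2_eq_square power3_eq_cube algebra_simps)
      finally show ?case .
    qed
  qed
  from tendsto_add[OF this S] show ?thesis by (simp add: Cp_def Cm_def)
qed

theorem theorem4p3:
  fixes \<sigma> lam \<epsilon>' :: real
    and M :: nat
    and k :: "nat \<Rightarrow> real"
    and f :: "(nat \<Rightarrow> real) \<Rightarrow> real"
    and F :: "real \<Rightarrow> (nat \<Rightarrow> real) \<Rightarrow> real"
  assumes "\<sigma> \<noteq> 0"
    and "lam > 0"
    and "\<forall>j\<in>{1..M}. k j > 0"
    and "Ck M 3 f"
    and "\<epsilon>' > 0"
    and "\<forall>\<epsilon>. 0 < \<epsilon> \<and> \<epsilon> < \<epsilon>' \<longrightarrow> Ck M 3 (F \<epsilon>)"
    and "\<forall>x\<in>Xc M. \<forall>a\<in>{1..M}. \<forall>b\<in>{1..M}. \<forall>c\<in>{1..M}. \<exists>K. \<forall>\<epsilon>. 0 < \<epsilon> \<and> \<epsilon> < \<epsilon>' \<longrightarrow>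
           (\<forall>y\<in>nbhd M \<epsilon>' x. \<bar>partial a (partial b (partial c (rescale \<epsilon> (F \<epsilon>)))) y\<bar> \<le> K)"
    and "\<forall>x\<in>Xc M. ((\<lambda>\<epsilon>. F \<epsilon> (\<lambda>i. x i / \<epsilon>)) \<longlongrightarrow> f x) (at_right 0)"
    and "\<forall>x\<in>Xc M. \<forall>j\<in>{1..<M}.
           ((\<lambda>\<epsilon>. pdiff j (rescale \<epsilon> (F \<epsilon>)) x) \<longlongrightarrow> pdiff j f x) (at_right 0)"
    and "\<forall>x\<in>Xc M. \<forall>j\<in>{1..<M}.
           ((\<lambda>\<epsilon>. pdiff j (pdiff j (rescale \<epsilon> (F \<epsilon>))) x) \<longlongrightarrow> pdiff j (pdiff j f) x) (at_right 0)"
  shows "\<forall>x\<in>Xc M.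
           ((\<lambda>\<epsilon>. asip_gen M (1 - \<epsilon> * \<sigma>) k (lam / \<epsilon>) (F \<epsilon> \<circ> incl) (floor_vec (\<lambda>i. x i / \<epsilon>)))
             \<longlongrightarrow> abep_gen M \<sigma> k lam f x) (at_right 0)"
proof
  fix x assume x: "x \<in> Xc M"
  \<comment> \<open>Both generators are sums over the same bonds, so the limit is taken term by
    term.\<close>
  show "((\<lambda>\<epsilon>. asip_gen M (1 - \<epsilon> * \<sigma>) k (lam / \<epsilon>) (F \<epsilon> \<circ> incl) (floor_vec (\<lambda>i. x i / \<epsilon>)))
      \<longlongrightarrow> abep_gen M \<sigma> k lam f x) (at_right 0)"
    unfolding asip_gen_def abep_gen_def
    by (intro tendsto_sum site_generator_limit[OF assms(1,2,5) _ x]) (use assms(6-10) x in blast)+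
qed

end
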